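(* Let $\mathcal{C}$ be the class of languages accepted by constant-time two-sided error PACAs. Then $\mathsf{LLT}_{\cup\cap}\subseteq\mathcal C\subsetneq\mathsf{LTT}$.
   Context: PACA: a bounded one-dimensional CA with state set $Q$, input alphabet $\Sigma\subseteq Q$, accepting states $A\subseteq Q$, boundary symbol $\$$ and two local transition functions $\delta_0,\delta_1\colon Q_\$\times Q\times Q_\$\to Q$; at each step every cell independently tosses a fair coin $c$ and updates by $\delta_c$ applied to (left neighbor, itself, right neighbor), with $\$$ beyond the borders. On input $x\in\Sigma^n$ a computation is accepting if at some step all cells are in $A$. Time complexity $T$: every accepting computation on inputs of length $n$ first reaches $A^n$ at a step $<T(n)$; constant-time means $T$ is bounded by a constant. A two-sided error PACA for $L$ accepts every $x\in L$ with probability $\ge2/3$ and every $x\notin L$ with probability $\le1/3$ (over coin tosses). Languages are subsets of $\Sigma^+$. Notation: for a word $w$ and $\ell\in\mathbb N_0$, $p_\ell(w)$ (resp. $s_\ell(w)$) is the prefix (resp. suffix) of $w$ of length $\ell$ if $|w|\ge\ell$ and $w$ otherwise; $I_\ell(w)$ is the set of infixes of $w$ of length exactly $\ell$; $|w|_m$ is the number of occurrences of $m$ as an infix of $w$. $\mathsf{LTT}$ (locally threshold testable): $L\subseteq\Sigma^*$ is in $\mathsf{LTT}$ if there are $\theta,\ell\in\mathbb N_+$ such that for all $w_1,w_2$ with $p_{\ell-1}(w_1)=p_{\ell-1}(w_2)$, $s_{\ell-1}(w_1)=s_{\ell-1}(w_2)$, and, for every $m\in\Sigma^\ell$, ($|w_i|_m<\theta$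 for some $i\in\{1,2\}$ implies $|w_1|_m=|w_2|_m$), we have $w_1\in L\iff w_2\in L$. $\mathsf{LLT}$ (locally linearly testable): for $\ell\in\mathbb N_0$, $\theta\in\mathbb R_{\ge0}$, $\pi,\sigma\subseteq\Sigma^{\le\ell-1}$ and $\alpha\colon\Sigma^\ell\to\mathbb R_{\ge0}$, $\mathrm{LLin}_\ell(\pi,\sigma,\alpha,\theta)$ is the set of $w\in\Sigma^+$ with $p_{\ell-1}(w)\in\pi$, $s_{\ell-1}(w)\in\sigma$ and $\sum_{m\in\Sigma^\ell}\alpha(m)|w|_m\le\theta$; $\mathsf{LLT}$ is the class of all such languages. $\mathsf{LLT}_{\cup\cap}$ is the closure of $\mathsf{LLT}$ under (finite) union and intersection. *)

theory Defs
  imports Main Complex_Main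
begin

definition nonempty_words :: "'a list set" where
  "nonempty_words = {w. w \<noteq> []}"

definition pref :: "nat \<Rightarrow> 'a list \<Rightarrow> 'a list" where
  "pref l w = take l w"

definition suff :: "nat \<Rightarrow> 'a list \<Rightarrow> 'a list" where
  "suff l w = drop (length w - l) w"

definition occ :: "'a list \<Rightarrow> 'a list \<Rightarrow> nat" where
  "occ w m = card {i. i + length m \<le> length w \<and> take (length m) (drop i w) = m}"

definition LTT_param :: "nat \<Rightarrow> nat \<Rightarrow> 'a list set \<Rightarrow> bool" where
  "LTT_param \<theta> l L \<longleftrightarrow>
     (\<forall>w1 w2. pref (l - 1) w1 = pref (l - 1) w2 \<and> suff (l - 1) w1 = suff (l - 1) w2 \<and>
        (\<forall>m. length m = l \<longrightarrow> ((occ w1 m < \<theta> \<or> occ w2 m < \<theta>) \<longrightarrow> occ w1 m = occ w2 m))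
        \<longrightarrow> (w1 \<in> L \<longleftrightarrow> w2 \<in> L))"

text \<open>Class LTT (restricted to languages of nonempty words, the paper's convention).\<close>
definition LTT_class :: "'a list set set" where
  "LTT_class = {L. L \<subseteq> nonempty_words \<and> (\<exists>\<theta> l. \<theta> > 0 \<and> l > 0 \<and> LTT_param \<theta> l L)}"

definition LLin :: "nat \<Rightarrow> 'a list set \<Rightarrow> 'a list set \<Rightarrow> ('a list \<Rightarrow> real) \<Rightarrow> real \<Rightarrow> 'a list set" where
  "LLin l \<pi> \<sigma> \<alpha> \<theta> = {w. w \<noteq> [] \<and> pref (l - 1) w \<in> \<pi> \<and> suff (l - 1) w \<in> \<sigma> \<and>
      (\<Sum>m\<in>{m::'a list. length m = l}. \<alpha> m * real (occ w m)) \<le> \<theta>}"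

definition LLT_class :: "('a::finite) list set set" where
  "LLT_class = {LLin l \<pi> \<sigma> \<alpha> \<theta> | l \<pi> \<sigma> \<alpha> \<theta>.
      \<theta> \<ge> 0 \<and> \<pi> \<subseteq> {u. length u \<le> l - 1} \<and> \<sigma> \<subseteq> {u. length u \<le> l - 1} \<and>
      (\<forall>m. length m = l \<longrightarrow> \<alpha> m \<ge> 0)}"

inductive_set LLT_closure :: "('a::finite) list set set" where
  base: "L \<in> LLT_class \<Longrightarrow> L \<in> LLT_closure"
| union: "L1 \<in> LLT_closure \<Longrightarrow> L2 \<in> LLT_closure \<Longrightarrow> L1 \<union> L2 \<in> LLT_closure"
| inter: "L1 \<in> LLT_closure \<Longrightarrow> L2 \<in> LLT_closure \<Longrightarrow> L1 \<inter> L2 \<in> LLT_closure"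

text \<open>States are drawn from 'a + nat; the input symbol a is the state Inl a (so Sigma is a subset of Q).
  The boundary symbol $ is None.\<close>
record 'a paca =
  states :: "('a + nat) set"
  acc :: "('a + nat) set"
  delta :: "bool \<Rightarrow> ('a + nat) option \<Rightarrow> ('a + nat) \<Rightarrow> ('a + nat) option \<Rightarrow> ('a + nat)"

definition paca_wf :: "'a paca \<Rightarrow> bool" where
  "paca_wf M \<longleftrightarrow> finite (states M) \<and> range Inl \<subseteq> states M \<and> acc M \<subseteq> states M \<and>
     (\<forall>c l q r. set_option l \<subseteq> states M \<and> q \<in> states M \<and> set_option r \<subseteq> states M
        \<longrightarrow> delta M c l q r \<in> states M)"

definition paca_step :: "'a paca \<Rightarrow> bool list \<Rightarrow> ('a + nat) list \<Rightarrow> ('a + nat) list" where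
  "paca_step M cs conf =
     map (\<lambda>i. delta M (cs ! i)
                 (if i = 0 then None else Some (conf ! (i - 1)))
                 (conf ! i)
                 (if i + 1 = length conf then None else Some (conf ! (i + 1))))
         [0..<length conf]"

definition paca_run :: "'a paca \<Rightarrow> 'a list \<Rightarrow> bool list list \<Rightarrow> ('a + nat) list" where
  "paca_run M x css = fold (paca_step M) css (map Inl x)"

definition coins :: "nat \<Rightarrow> nat \<Rightarrow> bool list list set" where
  "coins t n = {css. length css = t \<and> (\<forall>cs\<in>set css. length cs = n)}"

definition all_acc :: "'a paca \<Rightarrow> ('a + nat) list \<Rightarrow> bool" where
  "all_acc M conf \<longleftrightarrow> set conf \<subseteq> acc M"

definition accepted_within :: "'a paca \<Rightarrow> 'a list \<Rightarrow> bool list list \<Rightarrow> bool" where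
  "accepted_within M x css \<longleftrightarrow> (\<exists>s \<le> length css. all_acc M (paca_run M x (take s css)))"

definition prob_within :: "'a paca \<Rightarrow> 'a list \<Rightarrow> nat \<Rightarrow> real" where
  "prob_within M x t =
     real (card {css \<in> coins t (length x). accepted_within M x css}) / 2 ^ (t * length x)"

text \<open>Acceptance probability: the probability of the event that A^n is reached at some step,
  i.e. the supremum of the increasing sequence prob_within M x t.\<close>
definition accept_prob :: "'a paca \<Rightarrow> 'a list \<Rightarrow> real" where
  "accept_prob M x = (SUP t. prob_within M x t)"

definition paca_const_time :: "'a paca \<Rightarrow> bool" where
  "paca_const_time M \<longleftrightarrow> (\<exists>T::nat. \<forall>x css. x \<noteq> [] \<longrightarrow> (\<forall>cs\<in>set css. length cs = length x) \<longrightarrow>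
       all_acc M (paca_run M x css) \<longrightarrow>
       (\<exists>s < T. s \<le> length css \<and> all_acc M (paca_run M x (take s css))))"

definition two_sided :: "'a paca \<Rightarrow> 'a list set \<Rightarrow> bool" where
  "two_sided M L \<longleftrightarrow> (\<forall>x. x \<noteq> [] \<longrightarrow>
      (x \<in> L \<longrightarrow> accept_prob M x \<ge> 2/3) \<and> (x \<notin> L \<longrightarrow> accept_prob M x \<le> 1/3))"

definition PACA_class :: "('a::finite) list set set" where
  "PACA_class = {L. L \<subseteq> nonempty_words \<and>
      (\<exists>M. paca_wf M \<and> paca_const_time M \<and> two_sided M L)}"

end

theory Submission
  imports Defs "HOL-Library.Countable" "HOL-Library.FuncSet"
begin

text \<open>
For \<open>LLT_closure \<subseteq> PACA_class\<close>, after replacing the weights by integers, a word of total weight \<open>s\<close>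
is accepted with probability \<open>2\<^sup>-\<^sup>s\<close> by the rule that the cell of an infix of weight \<open>w\<close> needs \<open>w\<close>
heads. Repetitions with all cells joined by "and" within a step and by "or" over the steps amplify
the gap at the threshold arbitrarily. Since the coins can be reused in later steps, acceptance
probabilities are closed under \<open>p q\<close> and \<open>1 - (1 - p) (1 - q)\<close>, which gives intersection and union.

For \<open>PACA_class \<subseteq> LTT_class\<close>, fix a set \<open>S\<close> of times and call a cell critical if it may fail to accept
at a time in \<open>S\<close>. Many critical cells make acceptance at all times in \<open>S\<close> unlikely. If there are
few, then left of every cell there is a nearby gap without critical cells, where the chain rule
can be cut off by independence; the acceptance probability is then a product of factors that
depend only on windows of bounded size and equal \<open>1\<close> unless the window has a critical centre.
Such windows are rare, so locally threshold equivalent words contain them equally often.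

The inclusion is strict because of the language of all words containing a letter \<open>a\<close>.
\<close>

section \<open>Uniformly random coin sets\<close>

text \<open>Acceptance is a union, over the times, of dependent events. What is local is the
  conjunction over all cells and a set of times, so every such set \<open>S\<close> is treated, and
  non-acceptance is recovered from these at the price of a factor \<open>2 ^ T\<close>. Hence
  closeness is required up to \<open>1 / (4 * 2 ^ T)\<close>, which leaves \<open>1 / 4\<close>,
  less than the distance between \<open>2 / 3\<close> and \<open>1 / 3\<close>.

  The obstacle is that a conditional probability may depend on remote cells through a chain of
  overlapping neighbourhoods. A stretch of \<open>2 * T\<close> cells that cannot fail breaks this
  chain. Fewer than \<open>K\<close> critical cells leave one of \<open>K\<close> disjoint stretches
  free, hence the radius \<open>2 * T * K\<close>.

  In the other direction the error has to be arbitrarily small, since unions and intersections add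
  errors. Reusing coins lets a conjunction of two disjunctions be rewritten as a disjunction of
  conjunctions, each of which all cells check in a single step, although these conjunctions are no
  longer independent.\<close>

definition pr :: "'i set \<Rightarrow> ('i set \<Rightarrow> bool) \<Rightarrow> real" where
  "pr I E = real (card {\<omega> \<in> Pow I. E \<omega>}) / 2 ^ card I"

text \<open>All sets are compared, not only subsets of a fixed coin set, so one such statement
  serves every finite set of coins around \<open>A\<close>.\<close>

definition depends_on :: "('i set \<Rightarrow> bool) \<Rightarrow> 'i set \<Rightarrow> bool" where
  "depends_on E A \<longleftrightarrow> (\<forall>\<omega> \<omega>'. \<omega> \<inter> A = \<omega>' \<inter> A \<longrightarrow> E \<omega> = E \<omega>')"

lemma depends_onI:
  "(\<And>\<omega> \<omega>'. (\<And>k. k \<in> A \<Longrightarrow> k \<in> \<omega> \<longleftrightarrow> k \<in> \<omega>') \<Longrightarrow> E \<omega> = E \<omega>') \<Longrightarrow> depends_on E A"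
  unfolding depends_on_def by blast

lemma depends_on_mono: "depends_on E A \<Longrightarrow> A \<subseteq> B \<Longrightarrow> depends_on E B"
  unfolding depends_on_def by (metis inf.absorb_iff2 inf_assoc)

lemma depends_on_Int: "depends_on E A \<Longrightarrow> E (\<omega> \<inter> A) = E \<omega>"
  unfolding depends_on_def by blast

lemma depends_on_conj:
  "depends_on E A \<Longrightarrow> depends_on F A \<Longrightarrow> depends_on (\<lambda>\<omega>. E \<omega> \<and> F \<omega>) A"
  unfolding depends_on_def by blast

lemma depends_on_not: "depends_on E A \<Longrightarrow> depends_on (\<lambda>\<omega>. \<not> E \<omega>) A"
  unfolding depends_on_def by blast

lemma pr_cong: "(\<And>\<omega>. \<omega> \<subseteq> I \<Longrightarrow> E \<omega> = F \<omega>) \<Longrightarrow> pr I E = pr I F"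
  unfolding pr_def by (metis (no_types, lifting) Collect_cong Pow_iff)

lemma pr_mono:
  assumes "finite I" "\<And>\<omega>. \<omega> \<subseteq> I \<Longrightarrow> E \<omega> \<Longrightarrow> F \<omega>"
  shows "pr I E \<le> pr I F"
  unfolding pr_def using assms
  by (intro divide_right_mono) (auto intro!: card_mono)

lemma pr_nonneg: "0 \<le> pr I E"
  by (simp add: pr_def)

lemma pr_True: "finite I \<Longrightarrow> pr I (\<lambda>\<omega>. True) = 1"
  by (simp add: pr_def card_Pow flip: Pow_def)

lemma pr_le_1: "finite I \<Longrightarrow> pr I E \<le> 1"
  using pr_mono[of I E "\<lambda>\<omega>. True"] by (simp add: pr_True)

lemma pr_split:
  assumes "finite I"
  shows "pr I E = pr I (\<lambda>\<omega>. E \<omega> \<and> F \<omega>) + pr I (\<lambda>\<omega>. E \<omega> \<and> \<not> F \<omega>)"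
proof -
  have "{\<omega> \<in> Pow I. E \<omega>} = {\<omega> \<in> Pow I. E \<omega> \<and> F \<omega>} \<union> {\<omega> \<in> Pow I. E \<omega> \<and> \<not> F \<omega>}"
    by auto
  then have "card {\<omega> \<in> Pow I. E \<omega>}
      = card {\<omega> \<in> Pow I. E \<omega> \<and> F \<omega>} + card {\<omega> \<in> Pow I. E \<omega> \<and> \<not> F \<omega>}"
    using assms by (simp only:) (subst card_Un_disjoint, auto)
  then show ?thesis by (simp add: pr_def add_divide_distrib)
qed

lemma pr_not: "finite I \<Longrightarrow> pr I (\<lambda>\<omega>. \<not> E \<omega>) = 1 - pr I E"
  using pr_split[of I "\<lambda>\<omega>. True" E] by (simp add: pr_True)

lemma pr_disj_le:
  assumes "finite I"
  shows "pr I (\<lambda>\<omega>. E \<omega> \<or> F \<omega>) \<le> pr I E + pr I F"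
proof -
  have "pr I (\<lambda>\<omega>. (E \<omega> \<or> F \<omega>) \<and> E \<omega>) \<le> pr I E" "pr I (\<lambda>\<omega>. (E \<omega> \<or> F \<omega>) \<and> \<not> E \<omega>) \<le> pr I F"
    using assms by (auto intro!: pr_mono)
  then show ?thesis using pr_split[OF assms, of "\<lambda>\<omega>. E \<omega> \<or> F \<omega>" E] by simp
qed

lemma pr_Bex_le:
  assumes "finite I" "finite S"
  shows "pr I (\<lambda>\<omega>. \<exists>s\<in>S. E s \<omega>) \<le> (\<Sum>s\<in>S. pr I (E s))"
  using assms(2)
proof (induction S)
  case empty
  then show ?case by (simp add: pr_def)
next
  case (insert a S)
  then show ?case using pr_disj_le[OF assms(1), of "E a" "\<lambda>\<omega>. \<exists>s\<in>S. E s \<omega>"] by simp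
qed

lemma pr_indep_Un:
  assumes "finite A" "finite B" "A \<inter> B = {}"
  shows "pr (A \<union> B) (\<lambda>\<omega>. E (\<omega> \<inter> A) \<and> F (\<omega> \<inter> B)) = pr A E * pr B F"
proof -
  have "bij_betw (\<lambda>\<omega>. (\<omega> \<inter> A, \<omega> \<inter> B)) {\<omega> \<in> Pow (A \<union> B). E (\<omega> \<inter> A) \<and> F (\<omega> \<inter> B)}
      ({\<omega> \<in> Pow A. E \<omega>} \<times> {\<omega> \<in> Pow B. F \<omega>})"
  proof (intro bij_betw_byWitness[where f' = "\<lambda>(a, b). a \<union> b"] ballI subsetI)
    fix p assume "p \<in> {\<omega> \<in> Pow A. E \<omega>} \<times> {\<omega> \<in> Pow B. F \<omega>}"
    then obtain a b where p: "p = (a, b)" "a \<subseteq> A" "b \<subseteq> B" by auto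
    then have "(a \<union> b) \<inter> A = a" "(a \<union> b) \<inter> B = b" using assms(3) by blast+
    with p show "(\<lambda>\<omega>. (\<omega> \<inter> A, \<omega> \<inter> B)) (case p of (a, b) \<Rightarrow> a \<union> b) = p" by simp
  next
    fix \<omega> assume "\<omega> \<in> (\<lambda>(a, b). a \<union> b) ` ({\<omega> \<in> Pow A. E \<omega>} \<times> {\<omega> \<in> Pow B. F \<omega>})"
    then obtain a b where ab: "\<omega> = a \<union> b" "a \<subseteq> A" "b \<subseteq> B" "E a" "F b" by auto
    then have "(a \<union> b) \<inter> A = a" "(a \<union> b) \<inter> B = b" using assms(3) by blast+
    with ab show "\<omega> \<in> {\<omega> \<in> Pow (A \<union> B). E (\<omega> \<inter> A) \<and> F (\<omega> \<inter> B)}" by auto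
  qed auto
  then have "card {\<omega> \<in> Pow (A \<union> B). E (\<omega> \<inter> A) \<and> F (\<omega> \<inter> B)}
      = card {\<omega> \<in> Pow A. E \<omega>} * card {\<omega> \<in> Pow B. F \<omega>}"
    by (simp only: bij_betw_same_card card_cartesian_product)
  then show ?thesis using assms by (simp add: pr_def card_Un_disjoint power_add)
qed

lemma pr_restrict:
  assumes "finite I" "A \<subseteq> I" "depends_on E A"
  shows "pr I E = pr A E"
proof -
  have fin: "finite A" "finite (I - A)" using assms finite_subset by blast+
  have "pr (A \<union> (I - A)) (\<lambda>\<omega>. E (\<omega> \<inter> A) \<and> True) = pr A E * pr (I - A) (\<lambda>\<omega>. True)"
    using fin by (intro pr_indep_Un[where F = "\<lambda>_. True"]) auto
  moreover have "A \<union> (I - A) = I" using assms by blast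
  ultimately show ?thesis using depends_on_Int[OF assms(3)] fin by (simp add: pr_True)
qed

lemma pr_indep:
  assumes "finite I" "A \<subseteq> I" "B \<subseteq> I" "A \<inter> B = {}" "depends_on E A" "depends_on F B"
  shows "pr I (\<lambda>\<omega>. E \<omega> \<and> F \<omega>) = pr I E * pr I F"
proof -
  have fin: "finite A" "finite B" using assms finite_subset by blast+
  have "depends_on (\<lambda>\<omega>. E \<omega> \<and> F \<omega>) (A \<union> B)"
    by (rule depends_on_conj; rule depends_on_mono) (use assms in auto)
  then have "pr I (\<lambda>\<omega>. E \<omega> \<and> F \<omega>) = pr (A \<union> B) (\<lambda>\<omega>. E \<omega> \<and> F \<omega>)"
    using assms by (intro pr_restrict) auto
  also have "\<dots> = pr A E * pr B F"
    using pr_indep_Un[OF fin assms(4), of E F] assms by (simp add: depends_on_Int)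
  finally show ?thesis using pr_restrict assms by metis
qed

lemma pr_reindex:
  assumes "inj_on f I"
  shows "pr (f ` I) E = pr I (\<lambda>\<omega>. E (f ` \<omega>))"
proof -
  have "inj_on ((`) f) (Pow I)" using assms by (rule inj_on_image_Pow)
  then have "inj_on ((`) f) {\<omega> \<in> Pow I. E (f ` \<omega>)}" by (rule inj_on_subset) auto
  moreover have "{\<omega> \<in> Pow (f ` I). E \<omega>} = (`) f ` {\<omega> \<in> Pow I. E (f ` \<omega>)}"
    by (auto simp: subset_image_iff)
  ultimately have "card {\<omega> \<in> Pow (f ` I). E \<omega>} = card {\<omega> \<in> Pow I. E (f ` \<omega>)}"
    by (simp add: card_image)
  then show ?thesis using assms by (simp add: pr_def card_image)
qed

lemma pr_superset:
  assumes "finite I" "D \<subseteq> I"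
  shows "pr I (\<lambda>\<omega>. D \<subseteq> \<omega>) = 1 / 2 ^ card D"
proof -
  have "pr I (\<lambda>\<omega>. D \<subseteq> \<omega>) = pr D (\<lambda>\<omega>. D \<subseteq> \<omega>)"
    using assms by (intro pr_restrict depends_onI) auto
  moreover have "{\<omega> \<in> Pow D. D \<subseteq> \<omega>} = {D}" by auto
  ultimately show ?thesis by (simp add: pr_def)
qed

text \<open>Excluding the events one at a time replaces inclusion-exclusion: the probability with \<open>a\<close>
  excluded is a difference of two probabilities without that exclusion, so the error doubles.\<close>
lemma pr_exclude_close:
  assumes fin: "finite I" "finite J" "finite A"
    and close: "\<And>S. S \<subseteq> U \<Longrightarrow> \<bar>pr I (\<lambda>\<omega>. \<forall>s\<in>S. E s \<omega>) - pr J (\<lambda>\<omega>. \<forall>s\<in>S. F s \<omega>)\<bar> \<le> \<eta>"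
    and sub: "S \<subseteq> U" "A \<subseteq> U"
  shows "\<bar>pr I (\<lambda>\<omega>. (\<forall>s\<in>S. E s \<omega>) \<and> (\<forall>s\<in>A. \<not> E s \<omega>))
    - pr J (\<lambda>\<omega>. (\<forall>s\<in>S. F s \<omega>) \<and> (\<forall>s\<in>A. \<not> F s \<omega>))\<bar> \<le> 2 ^ card A * \<eta>"
  using fin(3) sub
proof (induction A arbitrary: S rule: finite_induct)
  case empty
  then show ?case using close[of S] by simp
next
  case (insert a A)
  have step: "pr K (\<lambda>\<omega>. (\<forall>s\<in>S. G s \<omega>) \<and> (\<forall>s\<in>insert a A. \<not> G s \<omega>))
      = pr K (\<lambda>\<omega>. (\<forall>s\<in>S. G s \<omega>) \<and> (\<forall>s\<in>A. \<not> G s \<omega>))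
        - pr K (\<lambda>\<omega>. (\<forall>s\<in>insert a S. G s \<omega>) \<and> (\<forall>s\<in>A. \<not> G s \<omega>))"
    if "finite K" for K :: "'x set" and G
  proof -
    have "pr K (\<lambda>\<omega>. ((\<forall>s\<in>S. G s \<omega>) \<and> (\<forall>s\<in>A. \<not> G s \<omega>)) \<and> G a \<omega>)
        = pr K (\<lambda>\<omega>. (\<forall>s\<in>insert a S. G s \<omega>) \<and> (\<forall>s\<in>A. \<not> G s \<omega>))"
      "pr K (\<lambda>\<omega>. ((\<forall>s\<in>S. G s \<omega>) \<and> (\<forall>s\<in>A. \<not> G s \<omega>)) \<and> \<not> G a \<omega>)
        = pr K (\<lambda>\<omega>. (\<forall>s\<in>S. G s \<omega>) \<and> (\<forall>s\<in>insert a A. \<not> G s \<omega>))"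
      by (auto intro!: pr_cong)
    then show ?thesis
      using pr_split[OF that, of "\<lambda>\<omega>. (\<forall>s\<in>S. G s \<omega>) \<and> (\<forall>s\<in>A. \<not> G s \<omega>)" "G a"] by simp
  qed
  have "\<bar>pr I (\<lambda>\<omega>. (\<forall>s\<in>S. E s \<omega>) \<and> (\<forall>s\<in>A. \<not> E s \<omega>))
    - pr J (\<lambda>\<omega>. (\<forall>s\<in>S. F s \<omega>) \<and> (\<forall>s\<in>A. \<not> F s \<omega>))\<bar> \<le> 2 ^ card A * \<eta>"
    "\<bar>pr I (\<lambda>\<omega>. (\<forall>s\<in>insert a S. E s \<omega>) \<and> (\<forall>s\<in>A. \<not> E s \<omega>))
    - pr J (\<lambda>\<omega>. (\<forall>s\<in>insert a S. F s \<omega>) \<and> (\<forall>s\<in>A. \<not> F s \<omega>))\<bar> \<le> 2 ^ card A * \<eta>"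
    using insert.prems by (intro insert.IH; simp)+
  then show ?case
    unfolding step[OF fin(1)] step[OF fin(2)] using insert.hyps by simp
qed

section \<open>Space-time diagrams\<close>

definition pad :: "'a list \<Rightarrow> int \<Rightarrow> 'a option" where
  "pad x i = (if 0 \<le> i \<and> i < int (length x) then Some (x ! nat i) else None)"

lemma pad_eq_None: "pad x i = None \<longleftrightarrow> i \<notin> {0..<int (length x)}"
  by (auto simp: pad_def)

text \<open>The coin of cell \<open>i\<close> at time \<open>s\<close> shows heads iff \<open>(s, i)\<close> belongs to the set \<open>\<omega>\<close>; cells outside
  the word have state \<open>None\<close>, the boundary symbol.\<close>
fun cell :: "'a paca \<Rightarrow> (int \<Rightarrow> 'a option) \<Rightarrow> (nat \<times> int) set \<Rightarrow> nat \<Rightarrow> int \<Rightarrow> ('a + nat) option" where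
  "cell M X \<omega> 0 i = map_option Inl (X i)"
| "cell M X \<omega> (Suc t) i = (case cell M X \<omega> t i of None \<Rightarrow> None
    | Some q \<Rightarrow> Some (delta M ((t, i) \<in> \<omega>) (cell M X \<omega> t (i - 1)) q (cell M X \<omega> t (i + 1))))"

definition cell_ok :: "'a paca \<Rightarrow> (int \<Rightarrow> 'a option) \<Rightarrow> (nat \<times> int) set \<Rightarrow> nat \<Rightarrow> int \<Rightarrow> bool" where
  "cell_ok M X \<omega> t i \<longleftrightarrow> (\<forall>q. cell M X \<omega> t i = Some q \<longrightarrow> q \<in> acc M)"

lemma cell_eq_None: "cell M X \<omega> t i = None \<longleftrightarrow> X i = None"
  by (induction t) (auto split: option.splits)

lemma cell_ok_outside: "X i = None \<Longrightarrow> cell_ok M X \<omega> t i"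
  using cell_eq_None[of M X \<omega> t i] by (simp add: cell_ok_def)

text \<open>Information travels one cell per step. Cells outside the word never consult a coin, so
  agreement is asked for inside the word only; this makes the coins in \<open>space\<close>
  sufficient for all cells.\<close>

lemma cell_cong:
  assumes "\<And>j. \<bar>j - i\<bar> \<le> int t \<Longrightarrow> X j = X' j"
    and "\<And>s j. s < t \<Longrightarrow> \<bar>j - i\<bar> \<le> int t \<Longrightarrow> X j \<noteq> None \<Longrightarrow> (s, j) \<in> \<omega> \<longleftrightarrow> (s, j) \<in> \<omega>'"
  shows "cell M X \<omega> t i = cell M X' \<omega>' t i"
  using assms
proof (induction t arbitrary: i)
  case 0
  then show ?case by simp
next
  case (Suc t)
  have IH: "cell M X \<omega> t k = cell M X' \<omega>' t k" if "\<bar>k - i\<bar> \<le> 1" for k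
    using that by (intro Suc.IH Suc.prems) auto
  have "(t, i) \<in> \<omega> \<longleftrightarrow> (t, i) \<in> \<omega>'" if "cell M X \<omega> t i \<noteq> None"
    using that Suc.prems(2)[of t i] by (simp add: cell_eq_None)
  then show ?case by (auto simp: IH split: option.split)
qed

lemma cell_ok_cong:
  assumes "\<And>j. \<bar>j - i\<bar> \<le> int t \<Longrightarrow> X j = X' j"
    and "\<And>s j. s < t \<Longrightarrow> \<bar>j - i\<bar> \<le> int t \<Longrightarrow> X j \<noteq> None \<Longrightarrow> (s, j) \<in> \<omega> \<longleftrightarrow> (s, j) \<in> \<omega>'"
  shows "cell_ok M X \<omega> t i = cell_ok M X' \<omega>' t i"
  unfolding cell_ok_def using cell_cong[of i t X X' \<omega> \<omega>' M] assms by simp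

definition shift_coins :: "int \<Rightarrow> (nat \<times> int) set \<Rightarrow> (nat \<times> int) set" where
  "shift_coins k \<omega> = (\<lambda>(s, j). (s, j + k)) ` \<omega>"

lemma mem_shift_coins: "(s, j + k) \<in> shift_coins k \<omega> \<longleftrightarrow> (s, j) \<in> \<omega>"
  by (force simp: shift_coins_def)

lemma cell_shift: "cell M (\<lambda>d. X (d + k)) \<omega> t i = cell M X (shift_coins k \<omega>) t (i + k)"
proof (induction t arbitrary: i)
  case (Suc t)
  have shifts: "i - 1 + k = i + k - 1" "i + 1 + k = i + k + 1" by simp_all
  show ?case by (simp add: Suc shifts mem_shift_coins split: option.split)
qed simp

lemma cell_ok_shift: "cell_ok M (\<lambda>d. X (d + k)) \<omega> t i = cell_ok M X (shift_coins k \<omega>) t (i + k)"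
  by (simp add: cell_ok_def cell_shift)

section \<open>Runs as coin sets, and the acceptance probability\<close>

definition coin_set :: "nat \<Rightarrow> bool list list \<Rightarrow> (nat \<times> int) set" where
  "coin_set n css = {(s, i). s < length css \<and> 0 \<le> i \<and> i < int n \<and> css ! s ! nat i}"

definition space :: "nat \<Rightarrow> 'a list \<Rightarrow> (nat \<times> int) set" where
  "space t x = {..<t} \<times> {0..<int (length x)}"

lemma finite_space [simp]: "finite (space t x)"
  by (simp add: space_def)

lemma bij_coin_set: "bij_betw (coin_set n) (coins t n) (Pow ({..<t} \<times> {0..<int n}))"
proof (rule bij_betw_byWitness[where f' = "\<lambda>\<omega>. map (\<lambda>s. map (\<lambda>i. (s, int i) \<in> \<omega>) [0..<n]) [0..<t]"])
  show "\<forall>css\<in>coins t n. map (\<lambda>s. map (\<lambda>i. (s, int i) \<in> coin_set n css) [0..<n]) [0..<t] = css"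
    by (auto simp: coins_def coin_set_def intro!: nth_equalityI)
  show "\<forall>\<omega>\<in>Pow ({..<t} \<times> {0..<int n}).
      coin_set n (map (\<lambda>s. map (\<lambda>i. (s, int i) \<in> \<omega>) [0..<n]) [0..<t]) = \<omega>"
    by (fastforce simp: coin_set_def nat_less_iff)
  show "coin_set n ` coins t n \<subseteq> Pow ({..<t} \<times> {0..<int n})"
    by (auto simp: coins_def coin_set_def)
  show "(\<lambda>\<omega>. map (\<lambda>s. map (\<lambda>i. (s, int i) \<in> \<omega>) [0..<n]) [0..<t]) ` Pow ({..<t} \<times> {0..<int n}) \<subseteq> coins t n"
    by (auto simp: coins_def)
qed

lemma length_paca_run: "length (paca_run M x css) = length x"
  unfolding paca_run_def by (induction css rule: rev_induct) (auto simp: paca_step_def)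

lemma cell_paca_run:
  assumes "css \<in> coins t (length x)" "s \<le> t" "i < length x"
  shows "cell M (pad x) (coin_set (length x) css) s (int i) = Some (paca_run M x (take s css) ! i)"
  using assms(2,3)
proof (induction s arbitrary: i)
  case 0
  then show ?case by (simp add: pad_def paca_run_def)
next
  case (Suc s)
  have len: "length css = t" using assms(1) by (simp add: coins_def)
  have run: "paca_run M x (take (Suc s) css) = paca_step M (css ! s) (paca_run M x (take s css))"
    using Suc.prems len by (simp add: paca_run_def take_Suc_conv_app_nth)
  have coin: "(s, int i) \<in> coin_set (length x) css \<longleftrightarrow> css ! s ! i"
    using Suc.prems len by (simp add: coin_set_def)
  have left: "cell M (pad x) (coin_set (length x) css) s (int i - 1)
      = (if i = 0 then None else Some (paca_run M x (take s css) ! (i - 1)))"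
  proof (cases i)
    case (Suc k)
    then show ?thesis using Suc.IH[of k] Suc.prems by simp
  qed (simp add: cell_eq_None pad_def)
  have right: "cell M (pad x) (coin_set (length x) css) s (int i + 1)
      = (if i + 1 = length x then None else Some (paca_run M x (take s css) ! (i + 1)))"
  proof (cases "i + 1 = length x")
    case False
    then show ?thesis using Suc.IH[of "i + 1"] Suc.prems by (simp add: algebra_simps)
  qed (simp add: cell_eq_None pad_def)
  show ?case
    using Suc.IH[of i] Suc.prems
    by (simp add: run paca_step_def length_paca_run coin left right)
qed

lemma all_acc_iff_cell_ok:
  assumes "css \<in> coins t (length x)" "s \<le> t"
  shows "all_acc M (paca_run M x (take s css)) \<longleftrightarrow> (\<forall>i. cell_ok M (pad x) (coin_set (length x) css) s i)"
proof
  assume *: "all_acc M (paca_run M x (take s css))"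
  show "\<forall>i. cell_ok M (pad x) (coin_set (length x) css) s i"
  proof
    fix i
    show "cell_ok M (pad x) (coin_set (length x) css) s i"
    proof (cases "pad x i = None")
      case False
      then obtain k where "i = int k" "k < length x"
        by (metis atLeastLessThan_iff pad_eq_None nonneg_int_cases of_nat_less_iff)
      then show ?thesis
        using * cell_paca_run[OF assms, of k M] length_paca_run[of M x "take s css"]
        by (auto simp: cell_ok_def all_acc_def)
    qed (rule cell_ok_outside)
  qed
next
  assume "\<forall>i. cell_ok M (pad x) (coin_set (length x) css) s i"
  then have "paca_run M x (take s css) ! k \<in> acc M" if "k < length x" for k
    using cell_paca_run[OF assms that, of M] by (auto simp: cell_ok_def)
  then show "all_acc M (paca_run M x (take s css))"
    by (auto simp: all_acc_def in_set_conv_nth length_paca_run)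
qed

lemma cell_ok_depends:
  "t \<le> T \<Longrightarrow> depends_on (\<lambda>\<omega>. cell_ok M (pad x) \<omega> t i) (space T x)"
  by (rule depends_onI, rule cell_ok_cong) (auto simp: space_def pad_eq_None)

lemma prob_within_eq_pr:
  "prob_within M x t = pr (space t x) (\<lambda>\<omega>. \<exists>s\<le>t. \<forall>i. cell_ok M (pad x) \<omega> s i)"
proof -
  let ?n = "length x"
  have "bij_betw (coin_set ?n) (coins t ?n) (Pow (space t x))"
    using bij_coin_set by (simp add: space_def)
  then have "bij_betw (coin_set ?n) {css \<in> coins t ?n. accepted_within M x css}
      {\<omega> \<in> Pow (space t x). \<exists>s\<le>t. \<forall>i. cell_ok M (pad x) \<omega> s i}"
    by (rule bij_betw_Collect) (auto simp: accepted_within_def all_acc_iff_cell_ok coins_def)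
  then show ?thesis
    by (simp add: prob_within_def pr_def space_def bij_betw_same_card card_cartesian_product)
qed

definition acc_bound :: "'a paca \<Rightarrow> nat \<Rightarrow> bool" where
  "acc_bound M T \<longleftrightarrow> (\<forall>x css. x \<noteq> [] \<longrightarrow> (\<forall>cs\<in>set css. length cs = length x) \<longrightarrow>
       all_acc M (paca_run M x css) \<longrightarrow>
       (\<exists>s < T. s \<le> length css \<and> all_acc M (paca_run M x (take s css))))"

lemma paca_const_time_iff: "paca_const_time M \<longleftrightarrow> (\<exists>T. acc_bound M T)"
  by (simp add: paca_const_time_def acc_bound_def)

lemma acc_bound_mono: "acc_bound M T \<Longrightarrow> T \<le> T' \<Longrightarrow> acc_bound M T'"
  unfolding acc_bound_def by (meson order_less_le_trans)

definition accept_event :: "'a paca \<Rightarrow> nat \<Rightarrow> 'a list \<Rightarrow> (nat \<times> int) set \<Rightarrow> bool" where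
  "accept_event M T x \<omega> \<longleftrightarrow> (\<exists>s\<in>{..<T}. \<forall>i. cell_ok M (pad x) \<omega> s i)"

text \<open>The first accepting step lies below \<open>T\<close>, so \<open>prob_within\<close>
  stops growing at \<open>T\<close> and the supremum is a maximum.\<close>

lemma accept_prob_eq_pr:
  assumes "acc_bound M T" "x \<noteq> []"
  shows "accept_prob M x = pr (space T x) (accept_event M T x)"
proof -
  have *: "prob_within M x t = pr (space t x) (\<lambda>\<omega>. \<exists>s\<le>t. s < T \<and> (\<forall>i. cell_ok M (pad x) \<omega> s i))" for t
  proof -
    have "\<exists>s\<le>t. s < T \<and> (\<forall>i. cell_ok M (pad x) \<omega> s i)"
      if \<omega>: "\<omega> \<subseteq> space t x" and s: "s \<le> t" "\<forall>i. cell_ok M (pad x) \<omega> s i" for \<omega> s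
    proof -
      obtain css where css: "css \<in> coins t (length x)" "\<omega> = coin_set (length x) css"
        using bij_coin_set[of "length x" t] \<omega> unfolding bij_betw_def space_def by blast
      \<comment> \<open>The time bound is applied to the run cut off at step \<open>s\<close>, which
        yields an accepting step \<open>s' < T\<close> with \<open>s' \<le> s\<close>.\<close>
      have "all_acc M (paca_run M x (take s css))"
        using all_acc_iff_cell_ok[OF css(1) s(1)] s css by simp
      moreover have "\<forall>cs\<in>set (take s css). length cs = length x"
        using css(1) by (auto simp: coins_def dest: in_set_takeD)
      ultimately obtain s' where s': "s' < T" "s' \<le> s" "all_acc M (paca_run M x (take s' css))"
        using assms unfolding acc_bound_def
        by (smt (verit) length_take min.bounded_iff min.absorb1 take_take)
      then show ?thesis
        using all_acc_iff_cell_ok[OF css(1), of s'] s css by (intro exI[of _ s']) simp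
    qed
    then show ?thesis unfolding prob_within_eq_pr by (intro pr_cong) blast
  qed
  have ev: "depends_on (\<lambda>\<omega>. \<exists>s\<le>t. s < T \<and> (\<forall>i. cell_ok M (pad x) \<omega> s i)) (space t' x)"
    if "min t T \<le> t'" for t t'
    using cell_ok_depends[of _ t' M x] that unfolding depends_on_def
    by (smt (verit) min.bounded_iff le_trans less_imp_le min_def)
  have accept_event_eq: "accept_event M T x = (\<lambda>\<omega>. \<exists>s\<le>T. s < T \<and> (\<forall>i. cell_ok M (pad x) \<omega> s i))"
    by (intro ext) (auto simp: accept_event_def intro: less_imp_le)
  \<comment> \<open>Events up to \<open>t\<close> and up to \<open>T\<close> live on different coin
    sets; both are compared on the coins of \<open>t + T\<close> steps.\<close>
  have big: "pr (space T x) (accept_event M T x) = pr (space (t + T) x) (accept_event M T x)" for t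
  proof (rule pr_restrict[symmetric])
    show "depends_on (accept_event M T x) (space T x)"
      using ev[of T T] by (simp add: accept_event_eq)
  qed (auto simp: space_def)
  have "prob_within M x t \<le> pr (space T x) (accept_event M T x)" for t
  proof -
    have "prob_within M x t = pr (space (t + T) x) (\<lambda>\<omega>. \<exists>s\<le>t. s < T \<and> (\<forall>i. cell_ok M (pad x) \<omega> s i))"
      unfolding * by (rule pr_restrict[symmetric]; (rule ev)?) (auto simp: space_def)
    also have "\<dots> \<le> pr (space (t + T) x) (accept_event M T x)"
      by (intro pr_mono) (auto simp: accept_event_def)
    finally show ?thesis using big[of t] by simp
  qed
  moreover have "prob_within M x T = pr (space T x) (accept_event M T x)"
    unfolding * accept_event_eq ..
  ultimately show ?thesis
    unfolding accept_prob_def by (intro cSup_eq_maximum) (metis rangeI, blast)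
qed

section \<open>Acceptance probabilities of intervals of cells\<close>

text \<open>Abstracts \<open>\<forall>s\<in>S. cell_ok M X \<omega> s i\<close> for
  \<open>S \<subseteq> {..<T}\<close>. The comparison of equivalent words needs all these
  \<open>S\<close>, the separating language only singletons.\<close>

locale local_condition =
  fixes ok :: "(int \<Rightarrow> 'a option) \<Rightarrow> (nat \<times> int) set \<Rightarrow> int \<Rightarrow> bool" and T :: nat
  assumes ok_cong: "\<And>X X' \<omega> \<omega>' i.
      (\<And>j. \<bar>j - i\<bar> \<le> int T \<Longrightarrow> X j = X' j) \<Longrightarrow>
      (\<And>s j. s < T \<Longrightarrow> \<bar>j - i\<bar> \<le> int T \<Longrightarrow> X j \<noteq> None \<Longrightarrow> (s, j) \<in> \<omega> \<longleftrightarrow> (s, j) \<in> \<omega>') \<Longrightarrow>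
      ok X \<omega> i = ok X' \<omega>' i"
    and ok_shift: "\<And>X k \<omega> i. ok (\<lambda>d. X (d + k)) \<omega> i = ok X (shift_coins k \<omega>) (i + k)"
    and ok_outside: "\<And>X \<omega> i. X i = None \<Longrightarrow> ok X \<omega> i"
begin

definition crit :: "(int \<Rightarrow> 'a option) \<Rightarrow> int \<Rightarrow> bool" where
  "crit X i \<longleftrightarrow> (\<exists>\<omega>. \<not> ok X \<omega> i)"

text \<open>Not clipped to the word: the coins beyond its borders are harmless, and translations map
  boxes to boxes.\<close>

definition box :: "int \<Rightarrow> int \<Rightarrow> (nat \<times> int) set" where
  "box a b = {..<T} \<times> {a - int T..<b + int T}"

definition prob_ok :: "(int \<Rightarrow> 'a option) \<Rightarrow> int \<Rightarrow> int \<Rightarrow> real" where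
  "prob_ok X a b = pr (box a b) (\<lambda>\<omega>. \<forall>i\<in>{a..<b}. ok X \<omega> i)"

text \<open>The probability of one particular outcome of the coins in the box of a single
  cell.\<close>

definition \<beta> :: real where "\<beta> = 1 / 2 ^ (T * (2 * T + 1))"

lemma \<beta>_bounds: "0 < \<beta>" "\<beta> \<le> 1"
  by (simp_all add: \<beta>_def divide_simps)

lemma finite_box [simp]: "finite (box a b)"
  by (simp add: box_def)

lemma box_mono: "a' \<le> a \<Longrightarrow> b \<le> b' \<Longrightarrow> box a b \<subseteq> box a' b'"
  by (auto simp: box_def)

lemma depends_range: "depends_on (\<lambda>\<omega>. \<forall>i\<in>{a..<b}. ok X \<omega> i) (box a b)"
proof (intro depends_onI ball_cong refl ok_cong)
  fix \<omega> \<omega>' i s j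
  assume eq: "\<And>k. k \<in> box a b \<Longrightarrow> k \<in> \<omega> \<longleftrightarrow> k \<in> \<omega>'"
    and *: "i \<in> {a..<b}" "s < T" "\<bar>j - i\<bar> \<le> int T"
  from * have "(s, j) \<in> box a b" by (auto simp: box_def)
  then show "(s, j) \<in> \<omega> \<longleftrightarrow> (s, j) \<in> \<omega>'" by (rule eq)
qed

lemma prob_ok_box: "a' \<le> a \<Longrightarrow> b \<le> b' \<Longrightarrow> pr (box a' b') (\<lambda>\<omega>. \<forall>i\<in>{a..<b}. ok X \<omega> i) = prob_ok X a b"
  unfolding prob_ok_def by (intro pr_restrict depends_range box_mono) auto

lemma prob_ok_nonneg: "0 \<le> prob_ok X a b" and prob_ok_le_1: "prob_ok X a b \<le> 1"
  by (simp_all add: prob_ok_def pr_nonneg pr_le_1)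

lemma prob_ok_mono:
  assumes "a' \<le> a" "b \<le> b'"
  shows "prob_ok X a' b' \<le> prob_ok X a b"
  unfolding prob_ok_box[OF assms, symmetric] prob_ok_def[of X a' b']
  using assms by (intro pr_mono) auto

lemma prob_ok_no_crit:
  assumes "\<And>i. a \<le> i \<Longrightarrow> i < b \<Longrightarrow> \<not> crit X i"
  shows "prob_ok X a b = 1"
proof -
  have "prob_ok X a b = pr (box a b) (\<lambda>_. True)"
    unfolding prob_ok_def using assms by (intro pr_cong) (auto simp: crit_def)
  then show ?thesis by (simp add: pr_True)
qed

text \<open>Cells on the two sides of \<open>2 * T\<close> omitted cells read disjoint coins, and
  dropping the conditions in between only increases the probability.\<close>

lemma prob_ok_split_le:
  assumes "a \<le> b" "b + 2 * int T \<le> c" "c \<le> d"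
  shows "prob_ok X a d \<le> prob_ok X a b * prob_ok X c d"
proof -
  have "prob_ok X a d \<le> pr (box a d) (\<lambda>\<omega>. (\<forall>i\<in>{a..<b}. ok X \<omega> i) \<and> (\<forall>i\<in>{c..<d}. ok X \<omega> i))"
    unfolding prob_ok_def using assms by (intro pr_mono) auto
  also have "\<dots> = pr (box a d) (\<lambda>\<omega>. \<forall>i\<in>{a..<b}. ok X \<omega> i) * pr (box a d) (\<lambda>\<omega>. \<forall>i\<in>{c..<d}. ok X \<omega> i)"
    using assms
    by (intro pr_indep[OF _ box_mono box_mono _ depends_range depends_range]) (auto simp: box_def)
  finally show ?thesis using assms by (simp add: prob_ok_box)
qed

text \<open>If no omitted cell is critical, nothing is dropped and the bound becomes an
  equality.\<close>

lemma prob_ok_split_gap: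
  assumes "a \<le> b" "b + 2 * int T \<le> c" "c \<le> d" and gap: "\<And>i. b \<le> i \<Longrightarrow> i < c \<Longrightarrow> \<not> crit X i"
  shows "prob_ok X a d = prob_ok X a b * prob_ok X c d"
proof -
  have "prob_ok X a d = pr (box a d) (\<lambda>\<omega>. (\<forall>i\<in>{a..<b}. ok X \<omega> i) \<and> (\<forall>i\<in>{c..<d}. ok X \<omega> i))"
    unfolding prob_ok_def
  proof (rule pr_cong)
    fix \<omega>
    have "{a..<d} = {a..<b} \<union> {b..<c} \<union> {c..<d}" using assms(1-3) by auto
    moreover have "\<forall>i\<in>{b..<c}. ok X \<omega> i" using gap by (auto simp: crit_def)
    ultimately show "(\<forall>i\<in>{a..<d}. ok X \<omega> i)
        = ((\<forall>i\<in>{a..<b}. ok X \<omega> i) \<and> (\<forall>i\<in>{c..<d}. ok X \<omega> i))"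
      by blast
  qed
  also have "\<dots> = pr (box a d) (\<lambda>\<omega>. \<forall>i\<in>{a..<b}. ok X \<omega> i) * pr (box a d) (\<lambda>\<omega>. \<forall>i\<in>{c..<d}. ok X \<omega> i)"
    using assms(1-3)
    by (intro pr_indep[OF _ box_mono box_mono _ depends_range depends_range]) (auto simp: box_def)
  finally show ?thesis using assms(1-3) by (simp add: prob_ok_box)
qed

lemma prob_ok_step_noncrit:
  assumes "\<not> crit X i" "a \<le> i"
  shows "prob_ok X a (i + 1) = prob_ok X a i"
proof -
  have "prob_ok X a (i + 1) = pr (box a (i + 1)) (\<lambda>\<omega>. \<forall>i\<in>{a..<i}. ok X \<omega> i)"
    unfolding prob_ok_def
  proof (rule pr_cong)
    fix \<omega>
    have "j < i + 1 \<longleftrightarrow> j < i \<or> j = i" for j by auto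
    then show "(\<forall>j\<in>{a..<i + 1}. ok X \<omega> j) = (\<forall>j\<in>{a..<i}. ok X \<omega> j)"
      using assms by (auto simp: crit_def)
  qed
  then show ?thesis by (simp add: prob_ok_box)
qed

text \<open>A failing coin set may be cut down to the box of the cell, so at least one of the
  equally likely outcomes there fails.\<close>

lemma prob_ok_crit:
  assumes "crit X i"
  shows "prob_ok X i (i + 1) \<le> 1 - \<beta>"
proof -
  obtain \<omega> where \<omega>: "\<not> ok X \<omega> i" using assms by (auto simp: crit_def)
  have range: "{i..<i + 1} = {i}" by auto
  have bad: "\<not> ok X (\<omega> \<inter> box i (i + 1)) i"
    using depends_on_Int[OF depends_range[of i "i + 1" X], of \<omega>] \<omega> by (simp add: range)
  have "card {\<omega>' \<in> Pow (box i (i + 1)). ok X \<omega>' i} \<le> card (Pow (box i (i + 1)) - {\<omega> \<inter> box i (i + 1)})"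
    using bad by (intro card_mono) auto
  also have "\<dots> = 2 ^ card (box i (i + 1)) - 1"
    by (subst card_Diff_singleton) (auto simp: card_Pow)
  finally have "real (card {\<omega>' \<in> Pow (box i (i + 1)). ok X \<omega>' i}) \<le> 2 ^ card (box i (i + 1)) - 1"
    by (simp add: of_nat_diff flip: of_nat_le_iff[where 'a = real])
  moreover have "card (box i (i + 1)) = T * (2 * T + 1)"
    by (simp add: box_def card_cartesian_product nat_add_distrib nat_mult_distrib)
  ultimately show ?thesis
    unfolding prob_ok_def pr_def range by (simp add: \<beta>_def field_simps)
qed

text \<open>Greedy selection from the right: the last critical cell contributes a factor
  \<open>1 - \<beta>\<close>, and giving up the \<open>2 * T\<close> cells before it makes the rest
  independent. Each round thus uses up at most \<open>2 * T + 1\<close> critical cells.\<close>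

lemma prob_ok_small:
  assumes "(2 * T + 1) * k \<le> card {i \<in> {a..<b}. crit X i}"
  shows "prob_ok X a b \<le> (1 - \<beta>) ^ k"
  using assms
proof (induction k arbitrary: b)
  case 0
  then show ?case by (simp add: prob_ok_le_1)
next
  case (Suc k)
  let ?C = "{i \<in> {a..<b}. crit X i}"
  have "card ?C \<noteq> 0" using Suc.prems by simp
  then have "?C \<noteq> {}" by (metis card.empty)
  have fin: "finite ?C" by (rule finite_subset[of _ "{a..<b}"]) auto
  define i where "i = Max ?C"
  have i: "i \<in> ?C" "\<And>j. j \<in> ?C \<Longrightarrow> j \<le> i"
    unfolding i_def using fin \<open>?C \<noteq> {}\<close> by (rule Max_in, intro Max_ge fin)
  let ?c = "i - 2 * int T"
  have "?C \<subseteq> {j \<in> {a..<?c}. crit X j} \<union> {?c..i}" using i(2) by fastforce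
  then have "card ?C \<le> card ({j \<in> {a..<?c}. crit X j} \<union> {?c..i})"
    by (intro card_mono finite_UnI finite_subset[of "{j \<in> {a..<?c}. crit X j}" "{a..<?c}"]) auto
  also have "\<dots> \<le> card {j \<in> {a..<?c}. crit X j} + card {?c..i}" by (rule card_Un_le)
  also have "card {?c..i} = 2 * T + 1" by simp
  finally have IH: "prob_ok X a ?c \<le> (1 - \<beta>) ^ k" using Suc.prems by (intro Suc.IH) simp
  have "prob_ok X a b \<le> prob_ok X a (i + 1)" using i(1) by (intro prob_ok_mono) auto
  also have "\<dots> \<le> prob_ok X a ?c * prob_ok X i (i + 1)"
  proof (cases "a \<le> ?c")
    case True
    then show ?thesis by (intro prob_ok_split_le) auto
  next
    case False
    \<comment> \<open>The remaining interval is empty here.\<close>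
    then have "prob_ok X a ?c = 1" by (intro prob_ok_no_crit) auto
    then show ?thesis using i(1) by (simp add: prob_ok_mono)
  qed
  also have "\<dots> \<le> (1 - \<beta>) ^ k * (1 - \<beta>)"
    using IH i(1) \<beta>_bounds by (intro mult_mono prob_ok_crit prob_ok_nonneg) auto
  finally show ?case by (simp add: mult.commute)
qed

section \<open>Translation, locality and the chain rule\<close>

lemma prob_ok_shift: "prob_ok (\<lambda>d. X (d + k)) a b = prob_ok X (a + k) (b + k)"
proof -
  let ?f = "\<lambda>(s :: nat, j). (s, j + k)"
  have "?f ` box a b = box (a + k) (b + k)"
  proof (intro equalityI subsetI)
    fix p assume "p \<in> box (a + k) (b + k)"
    then show "p \<in> ?f ` box a b"
      by (intro image_eqI[where x = "(fst p, snd p - k)"]) (auto simp: box_def)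
  qed (auto simp: box_def)
  moreover have "inj_on ?f (box a b)" by (auto simp: inj_on_def)
  ultimately have "prob_ok X (a + k) (b + k)
      = pr (box a b) (\<lambda>\<omega>. \<forall>i\<in>{a + k..<b + k}. ok X (?f ` \<omega>) i)"
    using pr_reindex[of ?f "box a b"] by (simp add: prob_ok_def)
  also have "(\<lambda>\<omega>. \<forall>i\<in>{a + k..<b + k}. ok X (?f ` \<omega>) i)
      = (\<lambda>\<omega>. \<forall>i\<in>{a..<b}. ok (\<lambda>d. X (d + k)) \<omega> i)"
    unfolding ok_shift[of X k] shift_coins_def by (simp add: fun_eq_iff flip: image_add_atLeastLessThan')
  finally show ?thesis by (simp add: prob_ok_def)
qed

lemma prob_ok_cong:
  assumes "\<And>j. a - int T \<le> j \<Longrightarrow> j < b + int T \<Longrightarrow> X j = X' j"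
  shows "prob_ok X a b = prob_ok X' a b"
  unfolding prob_ok_def using assms by (intro pr_cong ball_cong refl ok_cong) auto

lemma crit_cong:
  assumes "\<And>j. \<bar>j - i\<bar> \<le> int T \<Longrightarrow> X j = X' j"
  shows "crit X i = crit X' i"
  unfolding crit_def using ok_cong[of i X X'] assms by metis

lemma crit_shift: "crit (\<lambda>d. X (d + k)) i = crit X (i + k)"
proof -
  have "surj (shift_coins k)"
  proof (rule surjI)
    show "shift_coins k (shift_coins (- k) \<omega>) = \<omega>" for \<omega>
      by (force simp: shift_coins_def)
  qed
  then show ?thesis unfolding crit_def ok_shift[of X k] by (metis surjD)
qed

lemma crit_pad: "crit (pad x) i \<Longrightarrow> i \<in> {0..<int (length x)}"
  using ok_outside[of "pad x" i] pad_eq_None[of x i] by (auto simp: crit_def)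

text \<open>Pigeonhole: \<open>K\<close> disjoint blocks of length \<open>s\<close> to the left of
  \<open>i\<close> cannot all meet a set with fewer than \<open>K\<close> elements there. The
  induction inspects the rightmost block first.\<close>

lemma exists_gap:
  assumes "finite C" "card (C \<inter> {i - int (s * K)..<i}) < K"
  shows "\<exists>c\<le>i. i - int (s * K) \<le> c - int s \<and> C \<inter> {c - int s..<c} = {}"
  using assms(2)
proof (induction K arbitrary: i)
  case (Suc K)
  show ?case
  proof (cases "C \<inter> {i - int s..<i} = {}")
    case False
    then obtain d where d: "d \<in> C" "d \<in> {i - int s..<i}" by blast
    have Suc_K: "int (s * Suc K) = int s + int (s * K)" by (simp add: algebra_simps)
    have "0 \<le> int (s * K)" by (rule of_nat_0_le_iff)
    then have "insert d (C \<inter> {i - int s - int (s * K)..<i - int s}) \<subseteq> C \<inter> {i - int (s * Suc K)..<i}"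
      unfolding Suc_K using d by (auto simp del: of_nat_mult of_nat_0_le_iff)
    then have "card (insert d (C \<inter> {i - int s - int (s * K)..<i - int s})) \<le> card (C \<inter> {i - int (s * Suc K)..<i})"
      using assms(1) by (intro card_mono) auto
    then have "card (C \<inter> {i - int s - int (s * K)..<i - int s}) < K"
      using Suc.prems d assms(1) by simp
    from Suc.IH[OF this] obtain c where "c \<le> i - int s"
      "i - int s - int (s * K) \<le> c - int s" "C \<inter> {c - int s..<c} = {}"
      by blast
    then show ?thesis unfolding Suc_K by (intro exI[of _ c]) simp
  qed (use Suc.prems in \<open>auto intro!: exI[of _ i] simp: algebra_simps\<close>)
qed simp

text \<open>The conditional probability that the origin is fine given that the \<open>R\<close> cells to its left are
  (where a noncritical origin gets the value \<open>1\<close> even if this condition has probability \<open>0\<close>).\<close>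
definition factor :: "nat \<Rightarrow> (int \<Rightarrow> 'a option) \<Rightarrow> real" where
  "factor R Y = (if crit Y 0 then prob_ok Y (- int R) 1 / prob_ok Y (- int R) 0 else 1)"

lemma factor_cong:
  assumes "\<And>d. \<bar>d\<bar> \<le> int (R + T) \<Longrightarrow> Y d = Y' d"
  shows "factor R Y = factor R Y'"
proof -
  have "prob_ok Y (- int R) 1 = prob_ok Y' (- int R) 1" "prob_ok Y (- int R) 0 = prob_ok Y' (- int R) 0"
    "crit Y 0 = crit Y' 0"
    using assms by (auto intro!: prob_ok_cong crit_cong)
  then show ?thesis by (simp add: factor_def)
qed

text \<open>Both conditional probabilities of cell \<open>i\<close>, given the cells from
  \<open>a\<close> on and given the last \<open>R\<close> cells, equal the one given the cells from
  \<open>c\<close> on: splitting at the gap before \<open>c\<close> cancels everything further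
  left.\<close>

lemma prob_ok_chain_step:
  assumes few: "card {i. crit X i} < K" "finite {i. crit X i}"
    and R: "R = 2 * T * K" and a: "a \<le> i - int R"
  shows "prob_ok X a (i + 1) = prob_ok X a i * factor R (\<lambda>d. X (d + i))"
proof (cases "crit X i")
  case False
  then have "\<not> crit (\<lambda>d. X (d + i)) 0" by (simp add: crit_shift)
  then show ?thesis using False a by (simp add: factor_def prob_ok_step_noncrit)
next
  case True
  then have crit0: "crit (\<lambda>d. X (d + i)) 0" by (simp add: crit_shift)
  have "card ({i. crit X i} \<inter> {i - int (2 * T * K)..<i}) \<le> card {i. crit X i}"
    using few by (intro card_mono) auto
  then obtain c where c: "c \<le> i" "i - int R \<le> c - int (2 * T)"
      "{i. crit X i} \<inter> {c - int (2 * T)..<c} = {}"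
    using exists_gap[OF few(2), of i "2 * T" K] few(1) R by auto
  let ?b = "c - 2 * int T"
  have gap: "\<not> crit X j" if "?b \<le> j" "j < c" for j using c(3) that by auto
  have split: "prob_ok X a' i' = prob_ok X a' ?b * prob_ok X c i'" if "a' \<le> i - int R" "i \<le> i'" for a' i'
    by (rule prob_ok_split_gap) (use c that gap in auto)
  have split_R: "prob_ok X (i - int R) i' = prob_ok X (i - int R) ?b * prob_ok X c i'" if "i \<le> i'" for i'
    using split that by simp
  have F: "factor R (\<lambda>d. X (d + i)) = prob_ok X (i - int R) (i + 1) / prob_ok X (i - int R) i"
    using crit0 by (simp add: factor_def prob_ok_shift algebra_simps)
  show ?thesis
  proof (cases "prob_ok X a i = 0")
    \<comment> \<open>Both sides vanish whatever the value of the quotient in \<open>factor\<close>,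
      even if its denominator is \<open>0\<close>.\<close>
    case True
    then have "prob_ok X a (i + 1) = 0"
      using prob_ok_mono[of a a i "i + 1" X] prob_ok_nonneg[of X a "i + 1"] by simp
    with True show ?thesis by simp
  next
    case False
    then have "prob_ok X a ?b \<noteq> 0" "prob_ok X c i \<noteq> 0" using split[OF a order_refl] by auto
    \<comment> \<open>The denominator in \<open>factor\<close> is nonzero because its interval is
      contained in the one from \<open>a\<close>.\<close>
    moreover have "prob_ok X a ?b \<le> prob_ok X (i - int R) ?b" using a by (intro prob_ok_mono) auto
    ultimately have "prob_ok X (i - int R) ?b \<noteq> 0" "prob_ok X c i \<noteq> 0"
      using prob_ok_nonneg[of X a ?b] by auto
    then show ?thesis using split[OF a] split_R F by (simp add: field_simps)
  qed
qed

text \<open>Starting at \<open>- int R\<close> gives even the first cells \<open>R\<close>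
  predecessors; those outside the word are not critical and cost nothing.\<close>

lemma prob_ok_chain:
  assumes few: "card {i. crit (pad x) i} < K" and R: "R = 2 * T * K"
  shows "prob_ok (pad x) (- int R) (int n) = (\<Prod>i\<in>{0..<int n}. factor R (\<lambda>d. pad x (d + i)))"
proof (induction n)
  case 0
  have "prob_ok (pad x) (- int R) 0 = 1" by (rule prob_ok_no_crit) (use crit_pad in force)
  then show ?case by simp
next
  case (Suc n)
  have "finite {i. crit (pad x) i}"
    by (rule finite_subset[of _ "{0..<int (length x)}"]) (use crit_pad in auto)
  then have "prob_ok (pad x) (- int R) (int n + 1)
      = prob_ok (pad x) (- int R) (int n) * factor R (\<lambda>d. pad x (d + int n))"
    using few R by (intro prob_ok_chain_step) auto
  moreover have "{0..<int (Suc n)} = insert (int n) {0..<int n}" by auto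
  ultimately show ?case using Suc by (simp add: mult.commute add.commute)
qed

lemma pr_space_eq_W:
  assumes "a \<le> 0" "int (length x) \<le> b"
  shows "pr (space T x) (\<lambda>\<omega>. \<forall>i. ok (pad x) \<omega> i) = prob_ok (pad x) a b"
proof -
  have "prob_ok (pad x) a b = pr (box a b) (\<lambda>\<omega>. \<forall>i. ok (pad x) \<omega> i)"
    unfolding prob_ok_def
  proof (rule pr_cong)
    fix \<omega>
    have "ok (pad x) \<omega> i" if "i \<notin> {a..<b}" for i
      using that assms by (intro ok_outside) (auto simp: pad_eq_None)
    then show "(\<forall>i\<in>{a..<b}. ok (pad x) \<omega> i) = (\<forall>i. ok (pad x) \<omega> i)" by blast
  qed
  also have "\<dots> = pr (space T x) (\<lambda>\<omega>. \<forall>i. ok (pad x) \<omega> i)"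
  proof (rule pr_restrict)
    show "depends_on (\<lambda>\<omega>. \<forall>i. ok (pad x) \<omega> i) (space T x)"
      by (intro depends_onI all_cong1 ok_cong) (auto simp: space_def pad_eq_None)
  qed (use assms in \<open>auto simp: box_def space_def\<close>)
  finally show ?thesis by simp
qed

end

lemma local_condition_cell_ok:
  assumes "S \<subseteq> {..<T}"
  shows "local_condition (\<lambda>X \<omega> i. \<forall>s\<in>S. cell_ok M X \<omega> s i) T"
proof
  fix X X' :: "int \<Rightarrow> 'a option" and \<omega> \<omega>' i
  assume "\<And>j. \<bar>j - i\<bar> \<le> int T \<Longrightarrow> X j = X' j"
    "\<And>s j. s < T \<Longrightarrow> \<bar>j - i\<bar> \<le> int T \<Longrightarrow> X j \<noteq> None \<Longrightarrow> (s, j) \<in> \<omega> \<longleftrightarrow> (s, j) \<in> \<omega>'"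
  then show "(\<forall>s\<in>S. cell_ok M X \<omega> s i) = (\<forall>s\<in>S. cell_ok M X' \<omega>' s i)"
    using assms by (intro ball_cong refl cell_ok_cong) auto
qed (simp_all add: cell_ok_shift cell_ok_outside)

section \<open>Locally threshold equivalent words\<close>

definition window :: "nat \<Rightarrow> (int \<Rightarrow> 'a option) \<Rightarrow> int \<Rightarrow> 'a option list" where
  "window r X i = map (\<lambda>k. X (i + int k - int r)) [0..<2 * r + 1]"

text \<open>Recentres a window at the origin, so that \<open>crit\<close> and \<open>factor\<close>
  can be evaluated on the window alone.\<close>

definition unwindow :: "nat \<Rightarrow> 'a option list \<Rightarrow> int \<Rightarrow> 'a option" where
  "unwindow r v d = (if \<bar>d\<bar> \<le> int r then v ! nat (d + int r) else None)"

lemma unwindow_window: "\<bar>d\<bar> \<le> int r \<Longrightarrow> unwindow r (window r X i) d = X (i + d)"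
  unfolding unwindow_def window_def by (subst nth_map_upt) auto

lemma window_eqI:
  assumes "\<And>d. \<bar>d\<bar> \<le> int r \<Longrightarrow> X (i + d) = Y (j + d)"
  shows "window r X i = window r Y j"
  unfolding window_def
proof (rule map_cong[OF refl])
  fix k assume "k \<in> set [0..<2 * r + 1]"
  then show "X (i + int k - int r) = Y (j + int k - int r)"
    using assms[of "int k - int r"] by (auto simp: algebra_simps)
qed

definition window_count :: "nat \<Rightarrow> 'a list \<Rightarrow> 'a option list \<Rightarrow> nat" where
  "window_count r x v = card {i \<in> {0..<int (length x)}. window r (pad x) i = v}"

definition LTT_equiv :: "nat \<Rightarrow> nat \<Rightarrow> 'a list \<Rightarrow> 'a list \<Rightarrow> bool" where
  "LTT_equiv \<theta> l w1 w2 \<longleftrightarrow> pref (l - 1) w1 = pref (l - 1) w2 \<and> suff (l - 1) w1 = suff (l - 1) w2 \<and>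
     (\<forall>m. length m = l \<longrightarrow> ((occ w1 m < \<theta> \<or> occ w2 m < \<theta>) \<longrightarrow> occ w1 m = occ w2 m))"

lemma LTT_equiv_sym: "LTT_equiv \<theta> l x y \<Longrightarrow> LTT_equiv \<theta> l y x"
  unfolding LTT_equiv_def by metis

lemma LTT_equivD:
  assumes "LTT_equiv \<theta> l x y"
  shows "take (l - 1) x = take (l - 1) y"
    and "drop (length x - (l - 1)) x = drop (length y - (l - 1)) y"
    and "length m = l \<Longrightarrow> occ x m < \<theta> \<Longrightarrow> occ x m = occ y m"
  using assms unfolding LTT_equiv_def pref_def suff_def by blast+

lemma LTT_param_iff: "LTT_param \<theta> l L \<longleftrightarrow> (\<forall>x y. LTT_equiv \<theta> l x y \<longrightarrow> (x \<in> L \<longleftrightarrow> y \<in> L))"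
  by (simp add: LTT_param_def LTT_equiv_def)

lemma LTT_equiv_short:
  assumes "LTT_equiv \<theta> l x y" "length x < l - 1"
  shows "x = y"
proof -
  have eq: "take (l - 1) x = take (l - 1) y" using assms(1) by (rule LTT_equivD)
  then have "length (take (l - 1) x) = length (take (l - 1) y)" by simp
  then show ?thesis using eq assms(2) by (simp add: min_def split: if_splits)
qed

lemma pad_prefix:
  assumes "take m x = take m y" "m \<le> length x" "m \<le> length y" "j < int m"
  shows "pad x j = pad y j"
proof (cases "0 \<le> j")
  case True
  then have "nat j < m" using assms(4) by (simp add: nat_less_iff)
  then have "x ! nat j = y ! nat j" using assms(1) by (metis nth_take)
  then show ?thesis using assms(2-4) True by (simp add: pad_def)
qed (simp add: pad_def)

lemma pad_suffix:
  assumes "drop (length x - m) x = drop (length y - m) y" "m \<le> length x" "m \<le> length y"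
    and "- int m \<le> j"
  shows "pad x (int (length x) + j) = pad y (int (length y) + j)"
proof (cases "j < 0")
  case True
  have "w ! nat (int (length w) + j) = drop (length w - m) w ! nat (int m + j)" if "m \<le> length w" for w :: "'a list"
  proof -
    have "nat (int (length w) + j) = length w - m + nat (int m + j)" using that assms(4) by linarith
    then show ?thesis using that by simp
  qed
  then have "x ! nat (int (length x) + j) = y ! nat (int (length y) + j)"
    using assms(1-3) by metis
  then show ?thesis using assms(2-4) True by (simp add: pad_def)
qed (simp add: pad_def)

lemma window_inner:
  assumes "p + (2 * r + 1) \<le> length x"
  shows "window r (pad x) (int p + int r) = map Some (take (2 * r + 1) (drop p x))"
proof (rule nth_equalityI)
  fix k assume "k < length (window r (pad x) (int p + int r))"
  then have k: "k < 2 * r + 1" by (simp add: window_def)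
  then have "window r (pad x) (int p + int r) ! k = pad x (int p + int r + int k - int r)"
    unfolding window_def by (subst nth_map_upt) auto
  moreover have "nat (int p + int k) = p + k" by simp
  ultimately show "window r (pad x) (int p + int r) ! k = map Some (take (2 * r + 1) (drop p x)) ! k"
    using k assms by (simp add: pad_def)
qed (use assms in \<open>simp add: window_def\<close>)

lemma card_inner_windows:
  assumes "2 * r \<le> length x"
  shows "card {i \<in> {int r..<int (length x) - int r}. window r (pad x) i = v}
    = (if length v = 2 * r + 1 \<and> None \<notin> set v then occ x (map the v) else 0)"
proof -
  let ?P = "{p. p + (2 * r + 1) \<le> length x \<and> map Some (take (2 * r + 1) (drop p x)) = v}"
  have "{i \<in> {int r..<int (length x) - int r}. window r (pad x) i = v} = (\<lambda>p. int p + int r) ` ?P"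
  proof (intro equalityI subsetI)
    fix i assume i: "i \<in> {i \<in> {int r..<int (length x) - int r}. window r (pad x) i = v}"
    then obtain p where p: "i = int p + int r" by (auto dest: zle_iff_zadd[THEN iffD1])
    then have "p + (2 * r + 1) \<le> length x" using i by auto
    then show "i \<in> (\<lambda>p. int p + int r) ` ?P" using i p window_inner by fastforce
  qed (auto simp: window_inner)
  then have "card {i \<in> {int r..<int (length x) - int r}. window r (pad x) i = v} = card ?P"
    by (simp add: card_image inj_on_def)
  also have "?P = (if length v = 2 * r + 1 \<and> None \<notin> set v
      then {p. p + (2 * r + 1) \<le> length x \<and> take (2 * r + 1) (drop p x) = map the v} else {})"
  proof (cases "length v = 2 * r + 1 \<and> None \<notin> set v")
    case True
    then have "Some (the o') = o'" if "o' \<in> set v" for o' using that by (metis option.collapse)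
    then have "map Some (map the v) = v" by (simp add: map_idI)
    then have "map Some u = v \<longleftrightarrow> u = map the v" for u by (auto simp: comp_def)
    with True show ?thesis by simp
  qed auto
  finally show ?thesis by (auto simp: occ_def)
qed

text \<open>The windows of the first \<open>r\<close> cells lie within the first
  \<open>2 * r\<close> letters or beyond the border, so the prefix of length \<open>l - 1\<close>
  with \<open>l = 2 * r + 1\<close> determines them; the suffix does the same at the other end. All
  other windows are infixes of length \<open>l\<close>.\<close>

lemma window_count_eq:
  assumes equiv: "LTT_equiv \<theta> (2 * r + 1) x y" and len: "2 * r \<le> length x" "2 * r \<le> length y"
    and small: "window_count r x v < \<theta>"
  shows "window_count r x v = window_count r y v"
proof -
  let ?C = "\<lambda>w I. card {i \<in> I. window r (pad w) i = v}"
  let ?in = "\<lambda>w. {int r..<int (length w) - int r}" and ?right = "\<lambda>w. {int (length w) - int r..<int (length w)}"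
  have split: "window_count r w v = ?C w {0..<int r} + ?C w (?in w) + ?C w (?right w)"
    if "2 * r \<le> length w" for w
  proof -
    let ?S = "\<lambda>I. {i \<in> I. window r (pad w) i = v}"
    have "finite (?S I)" if "finite I" for I using that by simp
    moreover have "{i \<in> {0..<int (length w)}. window r (pad w) i = v} = ?S {0..<int r} \<union> ?S (?in w) \<union> ?S (?right w)"
      using that by auto
    moreover have "(?S {0..<int r} \<union> ?S (?in w)) \<inter> ?S (?right w) = {}" "?S {0..<int r} \<inter> ?S (?in w) = {}"
      using that by auto
    ultimately show ?thesis
      unfolding window_count_def by (simp only: card_Un_disjoint finite_UnI finite_atLeastLessThan_int)
  qed
  have "window r (pad x) i = window r (pad y) i" if "i < int r" for i
    using LTT_equivD(1)[OF equiv] len that by (intro window_eqI pad_prefix[of "2 * r"]) auto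
  then have "{i \<in> {0..<int r}. window r (pad x) i = v} = {i \<in> {0..<int r}. window r (pad y) i = v}"
    by auto
  then have left: "?C x {0..<int r} = ?C y {0..<int r}" by simp
  have shift: "window r (pad x) (int (length x) + j) = window r (pad y) (int (length y) + j)"
    if "- int r \<le> j" for j
    using LTT_equivD(2)[OF equiv] len that
    by (intro window_eqI) (auto simp: add.assoc intro!: pad_suffix[of _ "2 * r"])
  have right: "?C w (?right w) = card {j \<in> {- int r..<0}. window r (pad w) (int (length w) + j) = v}" for w
  proof -
    have "{i \<in> ?right w. window r (pad w) i = v}
        = (\<lambda>j. int (length w) + j) ` {j \<in> {- int r..<0}. window r (pad w) (int (length w) + j) = v}"
    proof (intro equalityI subsetI)
      fix i assume "i \<in> {i \<in> ?right w. window r (pad w) i = v}"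
      then show "i \<in> (\<lambda>j. int (length w) + j) ` {j \<in> {- int r..<0}. window r (pad w) (int (length w) + j) = v}"
        by (intro image_eqI[of _ _ "i - int (length w)"]) auto
    qed auto
    then show ?thesis by (simp add: card_image)
  qed
  have "{j \<in> {- int r..<0}. window r (pad x) (int (length x) + j) = v}
      = {j \<in> {- int r..<0}. window r (pad y) (int (length y) + j) = v}"
    using shift by auto
  then have right_eq: "?C x (?right x) = ?C y (?right y)" unfolding right by simp
  have "?C x (?in x) < \<theta>" using small split[OF len(1)] by simp
  then have "?C x (?in x) = ?C y (?in y)"
    using LTT_equivD(3)[OF equiv, of "map the v"]
      card_inner_windows[OF len(1), of v] card_inner_windows[OF len(2), of v]
    by (auto split: if_splits)
  then show ?thesis using split len left right_eq by simp
qed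

section \<open>Acceptance probabilities of equivalent words\<close>

context local_condition
begin

lemma crit_unwindow:
  assumes "T \<le> r"
  shows "crit (unwindow r (window r X i)) 0 = crit X i"
proof -
  have "crit (unwindow r (window r X i)) 0 = crit (\<lambda>d. X (d + i)) 0"
    using assms by (intro crit_cong) (auto simp: unwindow_window add.commute)
  then show ?thesis by (simp add: crit_shift)
qed

lemma card_crit:
  assumes "finite V" "window r (pad x) ` {0..<int (length x)} \<subseteq> V" "T \<le> r"
  shows "card {i. crit (pad x) i} = (\<Sum>v\<in>{v \<in> V. crit (unwindow r v) 0}. window_count r x v)"
proof -
  have "{i. crit (pad x) i} = {i \<in> {0..<int (length x)}. crit (pad x) i}" using crit_pad by auto
  then have "card {i. crit (pad x) i} = (\<Sum>i\<in>{i \<in> {0..<int (length x)}. crit (pad x) i}. 1)" by simp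
  also have "\<dots> = (\<Sum>v\<in>{v \<in> V. crit (unwindow r v) 0}.
      \<Sum>i\<in>{i \<in> {i \<in> {0..<int (length x)}. crit (pad x) i}. window r (pad x) i = v}. 1)"
    using assms
    by (intro sum.group[symmetric])
      (auto simp: crit_unwindow intro: finite_subset[of _ "{0..<int (length x)}"])
  also have "\<dots> = (\<Sum>v\<in>{v \<in> V. crit (unwindow r v) 0}. window_count r x v)"
    unfolding window_count_def using assms(3)
    by (intro sum.cong refl) (auto simp: crit_unwindow intro!: arg_cong[where f = card])
  finally show ?thesis .
qed

text \<open>The radius \<open>R + T\<close> is what \<open>factor\<close> sees: \<open>R\<close>
  cells to the left, each with its neighbourhood of radius \<open>T\<close>.\<close>

lemma prob_ok_prod:
  assumes V: "finite V" "window r (pad x) ` {0..<int (length x)} \<subseteq> V"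
    and few: "card {i. crit (pad x) i} < K" and R: "R = 2 * T * K" "r = R + T"
  shows "prob_ok (pad x) (- int R) (int (length x)) = (\<Prod>v\<in>V. factor R (unwindow r v) ^ window_count r x v)"
proof -
  let ?I = "{0..<int (length x)}"
  have "prob_ok (pad x) (- int R) (int (length x)) = (\<Prod>i\<in>?I. factor R (unwindow r (window r (pad x) i)))"
    unfolding prob_ok_chain[OF few R(1)] using R(2)
    by (intro prod.cong refl factor_cong) (auto simp: unwindow_window add.commute)
  also have "\<dots> = (\<Prod>v\<in>V. \<Prod>i\<in>{i \<in> ?I. window r (pad x) i = v}. factor R (unwindow r (window r (pad x) i)))"
    using V by (intro prod.group[symmetric]) auto
  also have "\<dots> = (\<Prod>v\<in>V. factor R (unwindow r v) ^ window_count r x v)"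
    by (intro prod.cong refl) (simp add: window_count_def)
  finally show ?thesis .
qed

lemma pr_space_eq_if_few_crit:
  assumes equiv: "LTT_equiv \<theta> (2 * r + 1) x y" and len: "2 * r \<le> length x" "2 * r \<le> length y"
    and few: "card {i. crit (pad x) i} < K" "K \<le> \<theta>" and R: "R = 2 * T * K" "r = R + T"
  shows "pr (space T x) (\<lambda>\<omega>. \<forall>i. ok (pad x) \<omega> i) = pr (space T y) (\<lambda>\<omega>. \<forall>i. ok (pad y) \<omega> i)"
proof -
  \<comment> \<open>A common finite index set for both words; it does not presuppose a finite
    alphabet.\<close>
  define V where "V = window r (pad x) ` {0..<int (length x)} \<union> window r (pad y) ` {0..<int (length y)}"
  have V: "finite V" "window r (pad x) ` {0..<int (length x)} \<subseteq> V"
    "window r (pad y) ` {0..<int (length y)} \<subseteq> V"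
    by (auto simp: V_def)
  have "T \<le> r" using R by simp
  have eq: "window_count r x v = window_count r y v" if v: "v \<in> V" "crit (unwindow r v) 0" for v
  proof (rule window_count_eq[OF equiv len])
    have "window_count r x v \<le> card {i. crit (pad x) i}"
      unfolding card_crit[OF V(1,2) \<open>T \<le> r\<close>] using v V(1) by (intro member_le_sum) auto
    then show "window_count r x v < \<theta>" using few by simp
  qed
  \<comment> \<open>Only \<open>x\<close> is assumed to have few critical cells. The equal counts
    pass this on to \<open>y\<close>, so the product formula applies to both words.\<close>
  then have "card {i. crit (pad y) i} = card {i. crit (pad x) i}"
    using card_crit[OF V(1,2) \<open>T \<le> r\<close>] card_crit[OF V(1,3) \<open>T \<le> r\<close>] by simp
  then have few': "card {i. crit (pad y) i} < K" using few by simp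
  have "(\<Prod>v\<in>V. factor R (unwindow r v) ^ window_count r x v)
      = (\<Prod>v\<in>V. factor R (unwindow r v) ^ window_count r y v)"
    using eq by (intro prod.cong refl) (auto simp: factor_def)
  then have "prob_ok (pad x) (- int R) (int (length x)) = prob_ok (pad y) (- int R) (int (length y))"
    using prob_ok_prod[OF V(1,2) few(1) R] prob_ok_prod[OF V(1,3) few' R] by simp
  then show ?thesis
    using pr_space_eq_W[of "- int R" x "int (length x)"] pr_space_eq_W[of "- int R" y "int (length y)"]
    by simp
qed

lemma pr_space_small_if_many_crit:
  assumes "(2 * T + 1) * k \<le> card {i. crit (pad x) i}"
  shows "pr (space T x) (\<lambda>\<omega>. \<forall>i. ok (pad x) \<omega> i) \<le> (1 - \<beta>) ^ k"
proof -
  have "{i. crit (pad x) i} = {i \<in> {0..<int (length x)}. crit (pad x) i}" using crit_pad by auto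
  then have "prob_ok (pad x) 0 (int (length x)) \<le> (1 - \<beta>) ^ k" using assms by (intro prob_ok_small) simp
  then show ?thesis using pr_space_eq_W[of 0 x "int (length x)"] by simp
qed

text \<open>If one of the words has fewer than \<open>K\<close> critical cells, the probabilities
  are equal; otherwise both lie between \<open>0\<close> and \<open>\<eta>\<close>.\<close>

lemma pr_space_close:
  assumes "LTT_equiv K (2 * (2 * T * K + T) + 1) x y" "K = (2 * T + 1) * k" "(1 - \<beta>) ^ k \<le> \<eta>"
    and "2 * (2 * T * K + T) \<le> length x" "2 * (2 * T * K + T) \<le> length y"
  shows "\<bar>pr (space T x) (\<lambda>\<omega>. \<forall>i. ok (pad x) \<omega> i) - pr (space T y) (\<lambda>\<omega>. \<forall>i. ok (pad y) \<omega> i)\<bar> \<le> \<eta>"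
proof -
  have "0 \<le> \<eta>" using order_trans[OF _ assms(3), of 0] \<beta>_bounds by simp
  consider "card {i. crit (pad x) i} < K" | "card {i. crit (pad y) i} < K"
    | "K \<le> card {i. crit (pad x) i}" "K \<le> card {i. crit (pad y) i}"
    by linarith
  then show ?thesis
  proof cases
    case 1
    then show ?thesis using pr_space_eq_if_few_crit[OF assms(1,4,5) 1] \<open>0 \<le> \<eta>\<close> by simp
  next
    case 2
    then show ?thesis
      using pr_space_eq_if_few_crit[OF LTT_equiv_sym[OF assms(1)] assms(5,4) 2] \<open>0 \<le> \<eta>\<close> by simp
  next
    case 3
    then have "pr (space T x) (\<lambda>\<omega>. \<forall>i. ok (pad x) \<omega> i) \<le> \<eta>" "pr (space T y) (\<lambda>\<omega>. \<forall>i. ok (pad y) \<omega> i) \<le> \<eta>"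
      using pr_space_small_if_many_crit[of k x] pr_space_small_if_many_crit[of k y] assms(2,3) by auto
    then show ?thesis
      using pr_nonneg[of "space T x" "\<lambda>\<omega>. \<forall>i. ok (pad x) \<omega> i"]
        pr_nonneg[of "space T y" "\<lambda>\<omega>. \<forall>i. ok (pad y) \<omega> i"]
      by linarith
  qed
qed

lemma exists_power_small:
  assumes "0 < \<eta>"
  obtains k where "(1 - \<beta>) ^ k \<le> \<eta>"
  using real_arch_pow_inv[OF assms, of "1 - \<beta>"] \<beta>_bounds that by (auto intro: less_imp_le)

end

lemma accept_event_close:
  assumes "0 < T"
  obtains \<theta> l where "\<theta> > 0" "l > 1"
    "\<And>x y. LTT_equiv \<theta> l x y \<Longrightarrow>
       \<bar>pr (space T x) (accept_event M T x) - pr (space T y) (accept_event M T y)\<bar> \<le> 1 / 4"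
proof -
  \<comment> \<open>Any instance would do, since \<open>\<beta>\<close> depends on \<open>T\<close>
    only.\<close>
  interpret empty: local_condition "\<lambda>X \<omega> i. \<forall>s\<in>{}. cell_ok M X \<omega> s i" T
    by (rule local_condition_cell_ok) simp
  \<comment> \<open>Excluding all \<open>T\<close> times doubles the error \<open>T\<close> times
    and leaves \<open>1 / 4\<close>.\<close>
  define \<eta> :: real where "\<eta> = 1 / (4 * 2 ^ T)"
  obtain k where k: "(1 - local_condition.\<beta> T) ^ k \<le> \<eta>"
    using empty.exists_power_small[of \<eta>] by (auto simp: \<eta>_def)
  \<comment> \<open>Ensures a positive threshold \<open>K\<close>.\<close>
  have "k \<noteq> 0"
  proof
    assume "k = 0"
    then have "1 \<le> \<eta>" using k by simp
    moreover have "(1 :: real) \<le> 2 ^ T" by simp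
    ultimately show False by (simp add: \<eta>_def field_simps)
  qed
  define K where "K = (2 * T + 1) * k"
  show ?thesis
  proof (rule that[of K "2 * (2 * T * K + T) + 1"])
    show "0 < K" using \<open>k \<noteq> 0\<close> by (simp add: K_def)
    fix x y :: "'a list" assume equiv: "LTT_equiv K (2 * (2 * T * K + T) + 1) x y"
    show "\<bar>pr (space T x) (accept_event M T x) - pr (space T y) (accept_event M T y)\<bar> \<le> 1 / 4"
    proof (cases "x = y")
      case False
      \<comment> \<open>A word shorter than \<open>l - 1\<close> equals its own prefix and is
        equivalent to itself only.\<close>
      then have len: "2 * (2 * T * K + T) \<le> length x" "2 * (2 * T * K + T) \<le> length y"
        using LTT_equiv_short[OF equiv] LTT_equiv_short[OF LTT_equiv_sym[OF equiv]] by force+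
      have "\<bar>pr (space T x) (\<lambda>\<omega>. \<forall>s\<in>S. \<forall>i. cell_ok M (pad x) \<omega> s i)
          - pr (space T y) (\<lambda>\<omega>. \<forall>s\<in>S. \<forall>i. cell_ok M (pad y) \<omega> s i)\<bar> \<le> \<eta>" if "S \<subseteq> {..<T}" for S
      proof -
        have "(\<lambda>\<omega>. \<forall>s\<in>S. \<forall>i. cell_ok M X \<omega> s i) = (\<lambda>\<omega>. \<forall>i. \<forall>s\<in>S. cell_ok M X \<omega> s i)" for X by blast
        then show ?thesis
          using local_condition.pr_space_close[OF local_condition_cell_ok[OF that] equiv K_def k len] by simp
      qed
      \<comment> \<open>Rejection means that every time below \<open>T\<close> is excluded, so no
        time is required to succeed.\<close>
      then have "\<bar>pr (space T x) (\<lambda>\<omega>. (\<forall>s\<in>{}. \<forall>i. cell_ok M (pad x) \<omega> s i) \<and> (\<forall>s\<in>{..<T}. \<not> (\<forall>i. cell_ok M (pad x) \<omega> s i)))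
          - pr (space T y) (\<lambda>\<omega>. (\<forall>s\<in>{}. \<forall>i. cell_ok M (pad y) \<omega> s i) \<and> (\<forall>s\<in>{..<T}. \<not> (\<forall>i. cell_ok M (pad y) \<omega> s i)))\<bar>
          \<le> 2 ^ card {..<T} * \<eta>"
        by (intro pr_exclude_close[where U = "{..<T}"]) auto
      moreover have "(\<lambda>\<omega>. (\<forall>s\<in>{}. \<forall>i. cell_ok M (pad w) \<omega> s i) \<and> (\<forall>s\<in>{..<T}. \<not> (\<forall>i. cell_ok M (pad w) \<omega> s i)))
          = (\<lambda>\<omega>. \<not> accept_event M T w \<omega>)" for w
        by (auto simp: accept_event_def)
      moreover have "2 ^ card {..<T} * \<eta> = 1 / 4" by (simp add: \<eta>_def)
      ultimately show ?thesis by (simp only: pr_not finite_space)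
    qed simp
  qed (use \<open>0 < T\<close> in simp)
qed

text \<open>A change of at most \<open>1 / 4\<close> cannot lead from probability at least
  \<open>2 / 3\<close> to at most \<open>1 / 3\<close>.\<close>

lemma PACA_class_subset_LTT_class: "PACA_class \<subseteq> LTT_class"
proof
  fix L :: "'a list set" assume "L \<in> PACA_class"
  then obtain M T0 where L: "L \<subseteq> nonempty_words" and M: "two_sided M L" "acc_bound M T0"
    by (auto simp: PACA_class_def paca_const_time_iff)
  \<comment> \<open>A positive \<open>T\<close> gives \<open>l > 1\<close>, and then the empty word
    is equivalent to no other word.\<close>
  define T where "T = Suc T0"
  have bound: "acc_bound M T" using acc_bound_mono[OF M(2)] by (simp add: T_def)
  obtain \<theta> l where *: "\<theta> > 0" "l > 1" and close: "\<And>x y. LTT_equiv \<theta> l x y \<Longrightarrow>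
       \<bar>pr (space T x) (accept_event M T x) - pr (space T y) (accept_event M T y)\<bar> \<le> 1 / 4"
    using accept_event_close[of T M] by (auto simp: T_def)
  have imp: "y \<in> L" if equiv: "LTT_equiv \<theta> l x y" and "x \<in> L" for x y
  proof (rule ccontr)
    assume "y \<notin> L"
    then have "x \<noteq> y" using that by blast
    have "x \<noteq> []" using L \<open>x \<in> L\<close> by (auto simp: nonempty_words_def)
    moreover have "y \<noteq> []"
      using LTT_equiv_short[OF LTT_equiv_sym[OF equiv]] \<open>x \<noteq> y\<close> \<open>l > 1\<close> by auto
    ultimately have "accept_prob M x \<ge> 2 / 3" "accept_prob M y \<le> 1 / 3"
        "\<bar>accept_prob M x - accept_prob M y\<bar> \<le> 1 / 4"
      using close[OF equiv] M(1) \<open>x \<in> L\<close> \<open>y \<notin> L\<close> accept_prob_eq_pr[OF bound]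
      unfolding two_sided_def by simp_all
    then show False by linarith
  qed
  then have "LTT_param \<theta> l L" unfolding LTT_param_iff using LTT_equiv_sym by metis
  then show "L \<in> LTT_class" using L * unfolding LTT_class_def
    by (intro CollectI conjI exI[of _ \<theta>] exI[of _ l]) simp_all
qed

section \<open>Strictness\<close>

definition containing :: "'a \<Rightarrow> 'a list set" where
  "containing a = {w. a \<in> set w}"

lemma containing_in_LTT_class: "containing a \<in> LTT_class"
proof -
  have occ: "occ w [a] = 0 \<longleftrightarrow> a \<notin> set w" for w
  proof -
    have "{i. i + 1 \<le> length w \<and> take 1 (drop i w) = [a]} = {i. i < length w \<and> w ! i = a}"
      by (auto simp: take_Suc_conv_app_nth hd_drop_conv_nth take_Suc)
    moreover have "finite {i. i < length w \<and> w ! i = a}" by simp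
    ultimately show ?thesis by (auto simp: occ_def in_set_conv_nth)
  qed
  have "LTT_param 1 1 (containing a)"
    unfolding LTT_param_iff LTT_equiv_def containing_def mem_Collect_eq
  proof (intro allI impI, elim conjE)
    fix x y :: "'a list"
    assume "\<forall>m. length m = 1 \<longrightarrow> occ x m < 1 \<or> occ y m < 1 \<longrightarrow> occ x m = occ y m"
    then have "occ x [a] = 0 \<longleftrightarrow> occ y [a] = 0" by fastforce
    then show "a \<in> set x \<longleftrightarrow> a \<in> set y" by (simp add: occ)
  qed
  then show ?thesis
    by (auto simp: LTT_class_def nonempty_words_def containing_def intro!: exI[of _ 1])
qed

text \<open>A single letter \<open>a\<close> in the middle of a long word \<open>b \<dots> b\<close> can only make acceptance less
  likely: at the times when a cell surrounded by \<open>b\<close>s may reject, acceptance is unlikely anyway,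
  and at the other times the cells near the two ends decide.\<close>
lemma containing_not_in_PACA_class:
  assumes "a \<noteq> b"
  shows "containing a \<notin> PACA_class"
proof
  assume "containing a \<in> PACA_class"
  then obtain M T0 where M: "two_sided M (containing a)" "acc_bound M T0"
    by (auto simp: PACA_class_def paca_const_time_iff)
  define T where "T = Suc T0"
  have bound: "acc_bound M T" using acc_bound_mono[OF M(2)] by (simp add: T_def)
  let ?ok = "\<lambda>s X \<omega> i. \<forall>s\<in>{s}. cell_ok M X \<omega> s i"
  let ?crit = "\<lambda>s. local_condition.crit (?ok s)"
  have lc: "local_condition (?ok s) T" if "s < T" for s
    using that by (intro local_condition_cell_ok) simp
  \<comment> \<open>The union bound below runs over at most \<open>T\<close> times, with total error
    \<open>1 / 4\<close>.\<close>
  define \<eta> :: real where "\<eta> = 1 / (4 * real T)"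
  have "0 < \<eta>" by (simp add: \<eta>_def T_def)
  then obtain k where k: "(1 - local_condition.\<beta> T) ^ k \<le> \<eta>"
    using local_condition.exists_power_small[OF lc, of 0 \<eta>] by (auto simp: T_def)
  \<comment> \<open>Removing \<open>T\<close> cells at either end of the left block leaves
    \<open>(2 * T + 1) * k\<close> cells with only \<open>b\<close> around them, as many as the
    bound \<open>(1 - \<beta>) ^ k\<close> asks for.\<close>
  define n where "n = (2 * T + 1) * k + 2 * T"
  have n_ge: "2 * int T \<le> int n" by (simp add: n_def)
  define x where "x = replicate n b @ [a] @ replicate n b"
  define y where "y = replicate n b @ [b] @ replicate n b"
  have len: "length x = 2 * n + 1" "length y = 2 * n + 1" by (simp_all add: x_def y_def)
  have x_b: "pad x i = Some b" if "0 \<le> i" "i < int n" for i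
    using that by (simp add: pad_def x_def nth_append nat_less_iff)
  have y_b: "pad y i = Some b" if "0 \<le> i" "i < 2 * int n + 1" for i
    using that by (auto simp: pad_def y_def nth_append nth_Cons' nat_less_iff)
  have xy: "pad x i = pad y i" if "i \<noteq> int n" for i
    using that by (auto simp: pad_def x_def y_def nth_append nth_Cons')
  \<comment> \<open>At these times a cell that sees only \<open>b\<close> cannot fail, so replacing
    the central \<open>a\<close> by \<open>b\<close> cannot spoil acceptance.\<close>
  define S where "S = {s. s < T \<and> \<not> ?crit s (\<lambda>_. Some b) 0}"
  have crit_b: "?crit s X i = ?crit s (\<lambda>_. Some b) 0"
    if "s < T" "\<And>j. \<bar>j - i\<bar> \<le> int T \<Longrightarrow> X j = Some b" for s X i
  proof -
    have "?crit s X i = ?crit s (\<lambda>_. Some b) i" by (rule local_condition.crit_cong[OF lc]) (use that in auto)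
    also have "\<dots> = ?crit s (\<lambda>_. Some b) 0"
      using local_condition.crit_shift[OF lc[OF that(1)], of "\<lambda>_. Some b" i 0] by simp
    finally show ?thesis .
  qed
  have small: "pr (space T x) (\<lambda>\<omega>. \<forall>i. cell_ok M (pad x) \<omega> s i) \<le> \<eta>" if s: "s < T" "s \<notin> S" for s
  proof -
    have "?crit s (pad x) i" if "i \<in> {int T..<int n - int T}" for i
    proof -
      have "pad x j = Some b" if "\<bar>j - i\<bar> \<le> int T" for j
        using that \<open>i \<in> _\<close> by (intro x_b) auto
      then show ?thesis using s crit_b[OF s(1), of i "pad x"] by (simp add: S_def)
    qed
    then have "{int T..<int n - int T} \<subseteq> {i. ?crit s (pad x) i}" by auto
    moreover have "finite {i. ?crit s (pad x) i}"
      by (rule finite_subset[of _ "{0..<int (length x)}"]) (use local_condition.crit_pad[OF lc[OF s(1)]] in auto)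
    ultimately have "card {int T..<int n - int T} \<le> card {i. ?crit s (pad x) i}" by (intro card_mono)
    moreover have "int n - int T = int T + int ((2 * T + 1) * k)" by (simp add: n_def)
    then have "card {int T..<int n - int T} = (2 * T + 1) * k"
      by (simp del: of_nat_mult of_nat_add)
    ultimately have "(2 * T + 1) * k \<le> card {i. ?crit s (pad x) i}" by simp
    from local_condition.pr_space_small_if_many_crit[OF lc[OF s(1)] this] k show ?thesis by simp
  qed
  \<comment> \<open>Near the centre, a cell of \<open>y\<close> sees only \<open>b\<close> and
    cannot fail; every other cell sees the same letters and coins in both words.\<close>
  have transfer: "\<forall>i. cell_ok M (pad y) \<omega> s i" if s: "s \<in> S" and okx: "\<forall>i. cell_ok M (pad x) \<omega> s i" for s \<omega>
  proof
    fix i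
    have "s < T" using s by (simp add: S_def)
    show "cell_ok M (pad y) \<omega> s i"
    proof (cases "\<bar>int n - i\<bar> \<le> int T")
      case True
      then have "pad y j = Some b" if "\<bar>j - i\<bar> \<le> int T" for j
        using that n_ge by (intro y_b) auto
      then have "\<not> ?crit s (pad y) i"
        using crit_b[OF \<open>s < T\<close>, of i "pad y"] s by (simp add: S_def)
      then show ?thesis using local_condition.crit_def[OF lc[OF \<open>s < T\<close>]] by auto
    next
      case False
      then have "cell_ok M (pad x) \<omega> s i = cell_ok M (pad y) \<omega> s i"
        using \<open>s < T\<close> by (intro cell_ok_cong xy refl) auto
      then show ?thesis using okx by simp
    qed
  qed
  \<comment> \<open>Equal lengths give both words the same coins, so their runs are coupled: if
    \<open>x\<close> accepts at a time in \<open>S\<close>, so does \<open>y\<close> under the same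
    coins.\<close>
  have space: "space T x = space T y" by (simp add: space_def len)
  have "pr (space T x) (accept_event M T x)
      \<le> pr (space T x) (\<lambda>\<omega>. accept_event M T y \<omega> \<or> (\<exists>s\<in>{..<T} - S. \<forall>i. cell_ok M (pad x) \<omega> s i))"
    using transfer by (intro pr_mono finite_space) (unfold accept_event_def, blast)
  also have "\<dots> \<le> pr (space T x) (accept_event M T y)
      + pr (space T x) (\<lambda>\<omega>. \<exists>s\<in>{..<T} - S. \<forall>i. cell_ok M (pad x) \<omega> s i)"
    by (intro pr_disj_le) simp
  also have "pr (space T x) (\<lambda>\<omega>. \<exists>s\<in>{..<T} - S. \<forall>i. cell_ok M (pad x) \<omega> s i)
      \<le> (\<Sum>s\<in>{..<T} - S. pr (space T x) (\<lambda>\<omega>. \<forall>i. cell_ok M (pad x) \<omega> s i))"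
    by (intro pr_Bex_le) auto
  also have "\<dots> \<le> (\<Sum>s\<in>{..<T} - S. \<eta>)" using small by (intro sum_mono) auto
  also have "\<dots> \<le> (\<Sum>s\<in>{..<T}. \<eta>)" using \<open>0 < \<eta>\<close> by (intro sum_mono2) auto
  also have "\<dots> = 1 / 4" by (simp add: \<eta>_def T_def)
  finally have "pr (space T x) (accept_event M T x) \<le> pr (space T y) (accept_event M T y) + 1 / 4"
    by (simp add: space)
  moreover have "x \<noteq> []" "y \<noteq> []" by (simp_all add: x_def y_def)
  note this[THEN accept_prob_eq_pr[OF bound]]
  ultimately have "accept_prob M x \<le> accept_prob M y + 1 / 4" by simp
  moreover have "accept_prob M x \<ge> 2 / 3"
    using M(1) by (simp add: two_sided_def containing_def x_def)
  moreover have "accept_prob M y \<le> 1 / 3"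
    using M(1) assms by (simp add: two_sided_def containing_def y_def)
  ultimately show False by simp
qed

section \<open>Realizable acceptance probabilities\<close>

definition local_in :: "nat \<Rightarrow> ((int \<Rightarrow> 'a option) \<Rightarrow> 'b) \<Rightarrow> bool" where
  "local_in N f \<longleftrightarrow> (\<forall>Y Y'. (\<forall>d. \<bar>d\<bar> \<le> int N \<longrightarrow> Y d = Y' d) \<longrightarrow> f Y = f Y')"

lemma local_in_mono: "local_in N f \<Longrightarrow> N \<le> N' \<Longrightarrow> local_in N' f"
  unfolding local_in_def by (meson of_nat_le_iff order_trans)

lemma local_inD: "local_in N f \<Longrightarrow> (\<And>d. \<bar>d\<bar> \<le> int N \<Longrightarrow> Y d = Y' d) \<Longrightarrow> f Y = f Y'"
  unfolding local_in_def by blast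

definition view :: "'a list \<Rightarrow> int \<Rightarrow> int \<Rightarrow> 'a option" where
  "view x i d = pad x (i + d)"

definition coins_at :: "(nat \<times> int) set \<Rightarrow> int \<Rightarrow> nat set" where
  "coins_at \<omega> i = {s. (s, i) \<in> \<omega>}"

definition slot_event :: "((int \<Rightarrow> 'a option) \<Rightarrow> nat set \<Rightarrow> bool) \<Rightarrow> 'a list \<Rightarrow> (nat \<times> int) set \<Rightarrow> bool" where
  "slot_event \<phi> x \<omega> \<longleftrightarrow> (\<forall>i\<in>{0..<int (length x)}. \<phi> (view x i) (coins_at \<omega> i))"

definition some_slot :: "((int \<Rightarrow> 'a option) \<Rightarrow> nat set \<Rightarrow> bool) list \<Rightarrow> 'a list \<Rightarrow> (nat \<times> int) set \<Rightarrow> bool" where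
  "some_slot \<phi>s x \<omega> \<longleftrightarrow> (\<exists>\<phi>\<in>set \<phi>s. slot_event \<phi> x \<omega>)"

text \<open>Each cell sees the input up to distance \<open>N\<close> and tosses \<open>N\<close> coins of its own; the list holds
  the acceptance conditions that a machine checks in successive steps with the same coins.\<close>
definition realizable :: "('a list \<Rightarrow> real) \<Rightarrow> bool" where
  "realizable p \<longleftrightarrow> (\<exists>N \<phi>s. (\<forall>\<phi>\<in>set \<phi>s. local_in N \<phi>) \<and>
     (\<forall>x. x \<noteq> [] \<longrightarrow> p x = pr (space N x) (some_slot \<phi>s x)))"

lemma realizable_bounds:
  assumes "realizable p" "x \<noteq> []"
  shows "0 \<le> p x" "p x \<le> 1"
  using assms by (auto simp: realizable_def pr_nonneg pr_le_1)

lemma realizable_const_1: "realizable (\<lambda>_. 1)"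
  unfolding realizable_def
  by (intro exI[of _ 0] exI[of _ "[\<lambda>_ _. True]"]) (simp add: local_in_def some_slot_def[abs_def] slot_event_def pr_True)

lemma realizable_const_0: "realizable (\<lambda>_. 0)"
  unfolding realizable_def
  by (intro exI[of _ 0] exI[of _ "[]"]) (simp add: some_slot_def pr_def)

lemma some_slot_single: "some_slot [\<phi>] x \<omega> = slot_event \<phi> x \<omega>"
  by (simp add: some_slot_def)

definition conj_slot :: "('b \<Rightarrow> 'c \<Rightarrow> bool) \<Rightarrow> ('b \<Rightarrow> 'c \<Rightarrow> bool) \<Rightarrow> 'b \<Rightarrow> 'c \<Rightarrow> bool" where
  "conj_slot \<phi> \<psi> Y C \<longleftrightarrow> \<phi> Y C \<and> \<psi> Y C"

text \<open>In each cell the first \<open>N1\<close> coins serve one list and the next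
  \<open>N2\<close> the other, which makes the two events independent. Stating their joint absence
  as well lets products and disjunctions share the construction.\<close>

lemma realizable_pair:
  assumes "realizable p" "realizable q"
  obtains N \<phi>s \<psi>s where
    "\<And>\<phi>. \<phi> \<in> set \<phi>s \<Longrightarrow> local_in N \<phi>" "\<And>\<psi>. \<psi> \<in> set \<psi>s \<Longrightarrow> local_in N \<psi>"
    "\<And>x. x \<noteq> [] \<Longrightarrow> pr (space N x) (\<lambda>\<omega>. some_slot \<phi>s x \<omega> \<and> some_slot \<psi>s x \<omega>) = p x * q x"
    "\<And>x. x \<noteq> [] \<Longrightarrow> pr (space N x) (\<lambda>\<omega>. \<not> some_slot \<phi>s x \<omega> \<and> \<not> some_slot \<psi>s x \<omega>) = (1 - p x) * (1 - q x)"
proof -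
  obtain N1 \<phi>s where loc1: "\<And>\<phi>. \<phi> \<in> set \<phi>s \<Longrightarrow> local_in N1 \<phi>"
    and p: "\<And>x. x \<noteq> [] \<Longrightarrow> p x = pr (space N1 x) (some_slot \<phi>s x)"
    using assms(1) by (auto simp: realizable_def)
  obtain N2 \<psi>s where loc2: "\<And>\<psi>. \<psi> \<in> set \<psi>s \<Longrightarrow> local_in N2 \<psi>"
    and q: "\<And>x. x \<noteq> [] \<Longrightarrow> q x = pr (space N2 x) (some_slot \<psi>s x)"
    using assms(2) by (auto simp: realizable_def)
  define \<phi>s' where "\<phi>s' = map (\<lambda>\<phi> Y C. \<phi> Y (C \<inter> {..<N1})) \<phi>s"
  define \<psi>s' where "\<psi>s' = map (\<lambda>\<psi> Y C. \<psi> Y {s. s < N2 \<and> s + N1 \<in> C}) \<psi>s"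
  define N where "N = N1 + N2"
  have loc: "local_in N \<phi>" if "\<phi> \<in> set \<phi>s' \<union> set \<psi>s'" for \<phi>
  proof -
    from that consider \<phi>0 where "\<phi>0 \<in> set \<phi>s" "\<phi> = (\<lambda>Y C. \<phi>0 Y (C \<inter> {..<N1}))"
      | \<psi> where "\<psi> \<in> set \<psi>s" "\<phi> = (\<lambda>Y C. \<psi> Y {s. s < N2 \<and> s + N1 \<in> C})"
      by (auto simp: \<phi>s'_def \<psi>s'_def)
    then show ?thesis
    proof cases
      case (1 \<phi>0)
      have "local_in N \<phi>0" using loc1[OF 1(1)] by (rule local_in_mono) (simp add: N_def)
      then show ?thesis unfolding 1(2) local_in_def by metis
    next
      case (2 \<psi>)
      have "local_in N \<psi>" using loc2[OF 2(1)] by (rule local_in_mono) (simp add: N_def)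
      then show ?thesis unfolding 2(2) local_in_def by metis
    qed
  qed
  have main: "pr (space N x) (some_slot \<phi>s' x) = p x" "pr (space N x) (some_slot \<psi>s' x) = q x"
    "depends_on (some_slot \<phi>s' x) (space N1 x)"
    "depends_on (some_slot \<psi>s' x) ({N1..<N} \<times> {0..<int (length x)})"
    if "x \<noteq> []" for x
  proof -
    let ?B = "{N1..<N} \<times> {0..<int (length x)}" and ?f = "\<lambda>(s, i :: int). (s + N1, i)"
    show dep1: "depends_on (some_slot \<phi>s' x) (space N1 x)"
    proof (rule depends_onI)
      fix \<omega> \<omega>' assume eq: "\<And>k. k \<in> space N1 x \<Longrightarrow> k \<in> \<omega> \<longleftrightarrow> k \<in> \<omega>'"
      have "coins_at \<omega> i \<inter> {..<N1} = coins_at \<omega>' i \<inter> {..<N1}" if "i \<in> {0..<int (length x)}" for i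
        using eq[of "(_, i)"] that by (auto simp: coins_at_def space_def)
      then show "some_slot \<phi>s' x \<omega> = some_slot \<phi>s' x \<omega>'"
        by (simp add: some_slot_def \<phi>s'_def slot_event_def)
    qed
    show dep2: "depends_on (some_slot \<psi>s' x) ?B"
    proof (rule depends_onI)
      fix \<omega> \<omega>' assume eq: "\<And>k. k \<in> ?B \<Longrightarrow> k \<in> \<omega> \<longleftrightarrow> k \<in> \<omega>'"
      have "{s. s < N2 \<and> s + N1 \<in> coins_at \<omega> i} = {s. s < N2 \<and> s + N1 \<in> coins_at \<omega>' i}"
        if "i \<in> {0..<int (length x)}" for i
        using eq[of "(_ + N1, i)"] that by (auto simp: coins_at_def N_def)
      then show "some_slot \<psi>s' x \<omega> = some_slot \<psi>s' x \<omega>'"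
        by (simp add: some_slot_def \<psi>s'_def slot_event_def)
    qed
    have "pr (space N x) (some_slot \<phi>s' x) = pr (space N1 x) (some_slot \<phi>s' x)"
      using dep1 by (intro pr_restrict) (auto simp: space_def N_def)
    also have "\<dots> = pr (space N1 x) (some_slot \<phi>s x)"
    proof (rule pr_cong)
      fix \<omega> assume "\<omega> \<subseteq> space N1 x"
      then have "coins_at \<omega> i \<inter> {..<N1} = coins_at \<omega> i" for i by (auto simp: coins_at_def space_def)
      then show "some_slot \<phi>s' x \<omega> = some_slot \<phi>s x \<omega>"
        by (simp add: some_slot_def \<phi>s'_def slot_event_def)
    qed
    finally show "pr (space N x) (some_slot \<phi>s' x) = p x" using p that by simp
    have B: "?B = ?f ` space N2 x"
    proof (intro equalityI subsetI)
      fix b assume "b \<in> ?B"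
      then show "b \<in> ?f ` space N2 x"
        by (intro image_eqI[of _ _ "(fst b - N1, snd b)"]) (auto simp: space_def N_def)
    qed (auto simp: space_def N_def)
    have "pr (space N x) (some_slot \<psi>s' x) = pr ?B (some_slot \<psi>s' x)"
      using dep2 by (intro pr_restrict) (auto simp: space_def N_def)
    also have "\<dots> = pr (space N2 x) (\<lambda>\<omega>. some_slot \<psi>s' x (?f ` \<omega>))"
      unfolding B by (rule pr_reindex) (auto simp: inj_on_def)
    also have "\<dots> = pr (space N2 x) (some_slot \<psi>s x)"
    proof (rule pr_cong)
      fix \<omega> assume "\<omega> \<subseteq> space N2 x"
      then have "{s. s < N2 \<and> s + N1 \<in> coins_at (?f ` \<omega>) i} = coins_at \<omega> i" for i
        by (force simp: coins_at_def space_def)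
      then show "some_slot \<psi>s' x (?f ` \<omega>) = some_slot \<psi>s x \<omega>"
        by (simp add: some_slot_def \<psi>s'_def slot_event_def)
    qed
    finally show "pr (space N x) (some_slot \<psi>s' x) = q x" using q that by simp
  qed
  show thesis
  proof (rule that[of \<phi>s' N \<psi>s'])
    fix x :: "'a list" assume x: "x \<noteq> []"
    note main = main[OF x]
    have indep: "pr (space N x) (\<lambda>\<omega>. E \<omega> \<and> F \<omega>) = pr (space N x) E * pr (space N x) F"
      if "depends_on E (space N1 x)" "depends_on F ({N1..<N} \<times> {0..<int (length x)})" for E F
      using that by (intro pr_indep) (auto simp: space_def N_def)
    show "pr (space N x) (\<lambda>\<omega>. some_slot \<phi>s' x \<omega> \<and> some_slot \<psi>s' x \<omega>) = p x * q x"
      using indep[OF main(3,4)] main(1,2) by simp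
    show "pr (space N x) (\<lambda>\<omega>. \<not> some_slot \<phi>s' x \<omega> \<and> \<not> some_slot \<psi>s' x \<omega>) = (1 - p x) * (1 - q x)"
      using indep[OF depends_on_not[OF main(3)] depends_on_not[OF main(4)]] main(1,2) by (simp add: pr_not)
  qed (use loc in auto)
qed

text \<open>Distributing the conjunction over both choices leaves one slot per pair, and a pair is
  again a condition on single cells. The pairs share coins, which is harmless because only the
  combined event matters.\<close>

lemma realizable_mult:
  fixes p q :: "'a list \<Rightarrow> real"
  assumes "realizable p" "realizable q"
  shows "realizable (\<lambda>x. p x * q x)"
proof -
  obtain N \<phi>s \<psi>s where loc: "\<And>\<phi>. \<phi> \<in> set \<phi>s \<Longrightarrow> local_in N \<phi>" "\<And>\<psi>. \<psi> \<in> set \<psi>s \<Longrightarrow> local_in N \<psi>"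
    and both: "\<And>x. x \<noteq> [] \<Longrightarrow> pr (space N x) (\<lambda>\<omega>. some_slot \<phi>s x \<omega> \<and> some_slot \<psi>s x \<omega>) = p x * q x"
    and "\<And>x. x \<noteq> [] \<Longrightarrow> pr (space N x) (\<lambda>\<omega>. \<not> some_slot \<phi>s x \<omega> \<and> \<not> some_slot \<psi>s x \<omega>) = (1 - p x) * (1 - q x)"
    by (rule realizable_pair[OF assms]) (rule that; blast)
  define \<chi>s where "\<chi>s = [conj_slot \<phi> \<psi>. \<phi> \<leftarrow> \<phi>s, \<psi> \<leftarrow> \<psi>s]"
  have "local_in N \<chi>" if mem: "\<chi> \<in> set \<chi>s" for \<chi>
  proof -
    obtain \<phi> \<psi> where *: "\<phi> \<in> set \<phi>s" "\<psi> \<in> set \<psi>s" and \<chi>: "\<chi> = conj_slot \<phi> \<psi>"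
      using mem by (auto simp: \<chi>s_def)
    show ?thesis
      unfolding local_in_def
    proof (intro allI impI)
      fix Y Y' :: "int \<Rightarrow> 'a option" assume "\<forall>d. \<bar>d\<bar> \<le> int N \<longrightarrow> Y d = Y' d"
      then have "\<phi> Y = \<phi> Y'" "\<psi> Y = \<psi> Y'"
        using local_inD[OF loc(1)[OF *(1)]] local_inD[OF loc(2)[OF *(2)]] by blast+
      then show "\<chi> Y = \<chi> Y'" by (simp add: \<chi> conj_slot_def fun_eq_iff)
    qed
  qed
  moreover have "some_slot \<chi>s x = (\<lambda>\<omega>. some_slot \<phi>s x \<omega> \<and> some_slot \<psi>s x \<omega>)" for x
    by (auto simp: fun_eq_iff some_slot_def slot_event_def \<chi>s_def conj_slot_def)
  ultimately show ?thesis using both unfolding realizable_def by metis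
qed

lemma realizable_or:
  assumes "realizable p" "realizable q"
  shows "realizable (\<lambda>x. 1 - (1 - p x) * (1 - q x))"
proof -
  obtain N \<phi>s \<psi>s where loc: "\<And>\<phi>. \<phi> \<in> set \<phi>s \<Longrightarrow> local_in N \<phi>" "\<And>\<psi>. \<psi> \<in> set \<psi>s \<Longrightarrow> local_in N \<psi>"
    and "\<And>x. x \<noteq> [] \<Longrightarrow> pr (space N x) (\<lambda>\<omega>. some_slot \<phi>s x \<omega> \<and> some_slot \<psi>s x \<omega>) = p x * q x"
    and none: "\<And>x. x \<noteq> [] \<Longrightarrow> pr (space N x) (\<lambda>\<omega>. \<not> some_slot \<phi>s x \<omega> \<and> \<not> some_slot \<psi>s x \<omega>) = (1 - p x) * (1 - q x)"
    by (rule realizable_pair[OF assms]) (rule that; blast)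
  have "some_slot (\<phi>s @ \<psi>s) x = (\<lambda>\<omega>. \<not> (\<not> some_slot \<phi>s x \<omega> \<and> \<not> some_slot \<psi>s x \<omega>))" for x
    by (auto simp: fun_eq_iff some_slot_def)
  then have "1 - (1 - p x) * (1 - q x) = pr (space N x) (some_slot (\<phi>s @ \<psi>s) x)" if "x \<noteq> []" for x
    using pr_not[of "space N x" "\<lambda>\<omega>. \<not> some_slot \<phi>s x \<omega> \<and> \<not> some_slot \<psi>s x \<omega>"] none that
    by simp
  then show ?thesis
    using loc unfolding realizable_def by (intro exI[of _ N] exI[of _ "\<phi>s @ \<psi>s"]) auto
qed

lemma realizable_power: "realizable p \<Longrightarrow> realizable (\<lambda>x. p x ^ j)"
  by (induction j) (simp_all add: realizable_const_1 realizable_mult)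

lemma realizable_repeat: "realizable p \<Longrightarrow> realizable (\<lambda>x. 1 - (1 - p x) ^ k)"
proof (induction k)
  case (Suc k)
  then show ?case using realizable_or[of p "\<lambda>x. 1 - (1 - p x) ^ k"] by simp
qed (simp add: realizable_const_0)

lemma realizable_local_weight:
  fixes g :: "(int \<Rightarrow> 'a option) \<Rightarrow> nat"
  assumes "local_in R b" "local_in R g" "\<And>Y. g Y \<le> B"
  shows "realizable (\<lambda>x. if \<forall>i\<in>{0..<int (length x)}. b (view x i)
    then 1 / 2 ^ (\<Sum>i\<in>{0..<int (length x)}. g (view x i)) else 0)"
proof -
  \<comment> \<open>In \<open>realizable\<close> one number serves both as radius of the view and as
    number of coins.\<close>
  define N where "N = max R B"
  define \<phi> where "\<phi> = (\<lambda>Y C. b Y \<and> {..<g Y} \<subseteq> C)"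
  have "local_in N \<phi>"
  proof -
    have "local_in R \<phi>" using assms(1,2) unfolding local_in_def \<phi>_def by (metis (mono_tags, lifting))
    then show ?thesis by (rule local_in_mono) (simp add: N_def)
  qed
  moreover have "(if \<forall>i\<in>{0..<int (length x)}. b (view x i)
    then 1 / 2 ^ (\<Sum>i\<in>{0..<int (length x)}. g (view x i)) else 0) = pr (space N x) (some_slot [\<phi>] x)" for x
  proof (cases "\<forall>i\<in>{0..<int (length x)}. b (view x i)")
    case True
    let ?D = "\<Union>i\<in>{0..<int (length x)}. {..<g (view x i)} \<times> {i}"
    have "?D \<subseteq> \<omega> \<longleftrightarrow> (\<forall>i\<in>{0..<int (length x)}. {..<g (view x i)} \<subseteq> coins_at \<omega> i)" for \<omega>
      unfolding coins_at_def by blast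
    then have "some_slot [\<phi>] x = (\<lambda>\<omega>. ?D \<subseteq> \<omega>)"
      using True by (simp add: fun_eq_iff some_slot_single slot_event_def \<phi>_def)
    moreover have "?D \<subseteq> space N x"
    proof -
      have "g (view x i) \<le> N" for i using assms(3)[of "view x i"] by (simp add: N_def)
      then show ?thesis by (auto simp: space_def intro: less_le_trans)
    qed
    moreover have "card ?D = (\<Sum>i\<in>{0..<int (length x)}. g (view x i))"
      by (subst card_UN_disjoint) (auto simp: card_cartesian_product)
    ultimately show ?thesis using True by (simp add: pr_superset)
  next
    case False
    then have "some_slot [\<phi>] x = (\<lambda>\<omega>. False)"
      by (auto simp: fun_eq_iff some_slot_single slot_event_def \<phi>_def)
    with False show ?thesis by (simp add: pr_def)
  qed
  ultimately show ?thesis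
    unfolding realizable_def by (intro exI[of _ N] exI[of _ "[\<phi>]"]) auto
qed

section \<open>Arbitrarily small error: unions, intersections and thresholds\<close>

definition amplifiable :: "'a list set \<Rightarrow> bool" where
  "amplifiable L \<longleftrightarrow> (\<forall>\<epsilon>>0. \<exists>p. realizable p \<and>
     (\<forall>x. x \<noteq> [] \<longrightarrow> (x \<in> L \<longrightarrow> 1 - \<epsilon> \<le> p x) \<and> (x \<notin> L \<longrightarrow> p x \<le> \<epsilon>)))"

lemma amplifiableE:
  assumes "amplifiable L" "0 < \<epsilon>"
  obtains p where "realizable p" "\<And>x. x \<noteq> [] \<Longrightarrow> x \<in> L \<Longrightarrow> 1 - \<epsilon> \<le> p x"
    "\<And>x. x \<noteq> [] \<Longrightarrow> x \<notin> L \<Longrightarrow> p x \<le> \<epsilon>"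
  using assms unfolding amplifiable_def by metis

text \<open>The errors add for words outside the union only, by
  \<open>1 - (1 - p) * (1 - q) \<le> p + q\<close>.\<close>

lemma amplifiable_Un:
  assumes "amplifiable L1" "amplifiable L2"
  shows "amplifiable (L1 \<union> L2)"
  unfolding amplifiable_def
proof (intro allI impI)
  fix \<epsilon> :: real assume "0 < \<epsilon>"
  then have "0 < \<epsilon> / 2" by simp
  obtain p where p: "realizable p" "\<And>x. x \<noteq> [] \<Longrightarrow> x \<in> L1 \<Longrightarrow> 1 - \<epsilon> / 2 \<le> p x"
    "\<And>x. x \<noteq> [] \<Longrightarrow> x \<notin> L1 \<Longrightarrow> p x \<le> \<epsilon> / 2"
    using amplifiableE[OF assms(1) \<open>0 < \<epsilon> / 2\<close>] by blast
  obtain q where q: "realizable q" "\<And>x. x \<noteq> [] \<Longrightarrow> x \<in> L2 \<Longrightarrow> 1 - \<epsilon> / 2 \<le> q x"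
    "\<And>x. x \<noteq> [] \<Longrightarrow> x \<notin> L2 \<Longrightarrow> q x \<le> \<epsilon> / 2"
    using amplifiableE[OF assms(2) \<open>0 < \<epsilon> / 2\<close>] by blast
  show "\<exists>p. realizable p \<and> (\<forall>x. x \<noteq> [] \<longrightarrow>
      (x \<in> L1 \<union> L2 \<longrightarrow> 1 - \<epsilon> \<le> p x) \<and> (x \<notin> L1 \<union> L2 \<longrightarrow> p x \<le> \<epsilon>))"
  proof (intro exI[of _ "\<lambda>x. 1 - (1 - p x) * (1 - q x)"] conjI allI impI realizable_or p q)
    fix x :: "'a list" assume "x \<noteq> []"
    note bounds = realizable_bounds[OF p(1) \<open>x \<noteq> []\<close>] realizable_bounds[OF q(1) \<open>x \<noteq> []\<close>]
    have "(1 - p x) * (1 - q x) \<le> (1 - p x) * 1" "(1 - p x) * (1 - q x) \<le> 1 * (1 - q x)"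
      using bounds by (intro mult_mono; simp)+
    moreover assume "x \<in> L1 \<union> L2"
    ultimately show "1 - \<epsilon> \<le> 1 - (1 - p x) * (1 - q x)"
      using p(2) q(2) \<open>x \<noteq> []\<close> \<open>0 < \<epsilon>\<close> by fastforce
  next
    fix x :: "'a list" assume "x \<noteq> []" "x \<notin> L1 \<union> L2"
    then have "0 \<le> p x * q x" "p x \<le> \<epsilon> / 2" "q x \<le> \<epsilon> / 2"
      using realizable_bounds[OF p(1)] realizable_bounds[OF q(1)] p(3) q(3) by auto
    then show "1 - (1 - p x) * (1 - q x) \<le> \<epsilon>" by (simp add: algebra_simps)
  qed
qed

text \<open>The errors add for words in the intersection only, by
  \<open>p * q \<ge> p + q - 1\<close>.\<close>

lemma amplifiable_Int:
  assumes "amplifiable L1" "amplifiable L2"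
  shows "amplifiable (L1 \<inter> L2)"
  unfolding amplifiable_def
proof (intro allI impI)
  fix \<epsilon> :: real assume "0 < \<epsilon>"
  then have "0 < \<epsilon> / 2" by simp
  obtain p where p: "realizable p" "\<And>x. x \<noteq> [] \<Longrightarrow> x \<in> L1 \<Longrightarrow> 1 - \<epsilon> / 2 \<le> p x"
    "\<And>x. x \<noteq> [] \<Longrightarrow> x \<notin> L1 \<Longrightarrow> p x \<le> \<epsilon> / 2"
    using amplifiableE[OF assms(1) \<open>0 < \<epsilon> / 2\<close>] by blast
  obtain q where q: "realizable q" "\<And>x. x \<noteq> [] \<Longrightarrow> x \<in> L2 \<Longrightarrow> 1 - \<epsilon> / 2 \<le> q x"
    "\<And>x. x \<noteq> [] \<Longrightarrow> x \<notin> L2 \<Longrightarrow> q x \<le> \<epsilon> / 2"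
    using amplifiableE[OF assms(2) \<open>0 < \<epsilon> / 2\<close>] by blast
  show "\<exists>p. realizable p \<and> (\<forall>x. x \<noteq> [] \<longrightarrow>
      (x \<in> L1 \<inter> L2 \<longrightarrow> 1 - \<epsilon> \<le> p x) \<and> (x \<notin> L1 \<inter> L2 \<longrightarrow> p x \<le> \<epsilon>))"
  proof (intro exI[of _ "\<lambda>x. p x * q x"] conjI allI impI realizable_mult p q)
    fix x :: "'a list" assume "x \<noteq> []" "x \<in> L1 \<inter> L2"
    then have "0 \<le> (1 - p x) * (1 - q x)" "1 - \<epsilon> / 2 \<le> p x" "1 - \<epsilon> / 2 \<le> q x"
      using realizable_bounds[OF p(1)] realizable_bounds[OF q(1)] p(2) q(2) by auto
    then show "1 - \<epsilon> \<le> p x * q x" by (simp add: algebra_simps)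
  next
    fix x :: "'a list" assume "x \<noteq> []"
    note bounds = realizable_bounds[OF p(1) \<open>x \<noteq> []\<close>] realizable_bounds[OF q(1) \<open>x \<noteq> []\<close>]
    have "p x * q x \<le> p x * 1" "p x * q x \<le> 1 * q x"
      using bounds by (intro mult_mono; simp)+
    moreover assume "x \<notin> L1 \<inter> L2"
    ultimately show "p x * q x \<le> \<epsilon>"
      using p(3) q(3) \<open>x \<noteq> []\<close> \<open>0 < \<epsilon>\<close> by fastforce
  qed
qed

text \<open>One slot accepts with probability \<open>2\<^sup>-\<^sup>s\<close> for total weight \<open>s\<close>; the power \<open>j\<close> makes the ratio
  between \<open>s \<le> \<Theta>\<close> and \<open>s > \<Theta>\<close> large, and \<open>k\<close> repetitions then lift the former close to \<open>1\<close>.\<close>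
lemma amplifiable_threshold:
  fixes g :: "(int \<Rightarrow> 'a option) \<Rightarrow> nat"
  assumes "local_in R b" "local_in R g" "\<And>Y. g Y \<le> B"
  shows "amplifiable {x. x \<noteq> [] \<and> (\<forall>i\<in>{0..<int (length x)}. b (view x i)) \<and>
    (\<Sum>i\<in>{0..<int (length x)}. g (view x i)) \<le> \<Theta>}"
  unfolding amplifiable_def
proof (intro allI impI)
  fix \<epsilon> :: real assume "0 < \<epsilon>"
  define p where "p = (\<lambda>x. if \<forall>i\<in>{0..<int (length x)}. b (view x i)
    then 1 / 2 ^ (\<Sum>i\<in>{0..<int (length x)}. g (view x i)) else (0 :: real))"
  have p: "realizable p" unfolding p_def by (rule realizable_local_weight) (rule assms)+
  \<comment> \<open>On words of the language one round succeeds with probability at least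
    \<open>q\<close>, and \<open>k\<close> is chosen with \<open>q * k\<close> between
    \<open>c\<close> and \<open>c + 1\<close>. All rounds fail with probability at most
    \<open>(1 - q) ^ k \<le> exp (- c)\<close>. For other words a round succeeds with probability at
    most \<open>q / 2 ^ j\<close>, and some round with at most \<open>(c + 1) / 2 ^ j\<close>. Both
    bounds are at most \<open>\<epsilon>\<close>.\<close>
  obtain c :: nat where c: "exp (- real c) \<le> \<epsilon>"
  proof -
    obtain c :: nat where "- ln \<epsilon> \<le> real c" using real_arch_simple by blast
    then have "exp (- real c) \<le> exp (ln \<epsilon>)" by (subst exp_le_cancel_iff) simp
    then show thesis using that \<open>0 < \<epsilon>\<close> by simp
  qed
  obtain j :: nat where j: "(1 / 2) ^ j \<le> \<epsilon> / (real c + 1)"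
    using real_arch_pow_inv[of "\<epsilon> / (real c + 1)" "1 / 2"] \<open>0 < \<epsilon>\<close> by (force intro: less_imp_le)
  define q :: real where "q = (1 / 2) ^ (\<Theta> * j)"
  have q: "0 < q" "q \<le> 1" by (auto simp: q_def power_le_one)
  define k where "k = nat \<lceil>real c / q\<rceil>"
  have k: "real c \<le> q * real k" "q * real k \<le> real c + 1"
  proof -
    have "real c / q \<le> real k" by (simp add: k_def real_nat_ceiling_ge)
    then show "real c \<le> q * real k" using q by (simp add: field_simps)
    have "real k \<le> real c / q + 1" using q by (simp add: k_def)
    then have "q * real k \<le> q * (real c / q + 1)" using q by (intro mult_left_mono) auto
    also have "\<dots> = real c + q" using q by (simp add: field_simps)
    finally show "q * real k \<le> real c + 1" using q by simp
  qed
  let ?L = "{x. x \<noteq> [] \<and> (\<forall>i\<in>{0..<int (length x)}. b (view x i)) \<and>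
    (\<Sum>i\<in>{0..<int (length x)}. g (view x i)) \<le> \<Theta>}"
  show "\<exists>p. realizable p \<and> (\<forall>x. x \<noteq> [] \<longrightarrow> (x \<in> ?L \<longrightarrow> 1 - \<epsilon> \<le> p x) \<and> (x \<notin> ?L \<longrightarrow> p x \<le> \<epsilon>))"
  proof (intro exI[of _ "\<lambda>x. 1 - (1 - p x ^ j) ^ k"] conjI allI impI realizable_repeat realizable_power p)
    fix x :: "'a list" assume "x \<noteq> []" "x \<in> ?L"
    then have "p x \<ge> (1 / 2) ^ \<Theta>"
      by (auto simp: p_def power_one_over[symmetric] intro!: power_decreasing)
    then have "q \<le> p x ^ j" unfolding q_def power_mult by (intro power_mono) auto
    moreover have "p x ^ j \<le> 1" using realizable_bounds[OF p \<open>x \<noteq> []\<close>] by (intro power_le_one)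
    ultimately have "(1 - p x ^ j) ^ k \<le> (1 - q) ^ k" by (intro power_mono) auto
    also have "\<dots> \<le> exp (- q) ^ k" using exp_ge_add_one_self[of "- q"] q by (intro power_mono) auto
    also have "\<dots> = exp (- (q * real k))" by (simp add: exp_of_nat_mult[symmetric] mult.commute)
    also have "\<dots> \<le> exp (- real c)" using k by simp
    finally show "1 - \<epsilon> \<le> 1 - (1 - p x ^ j) ^ k" using c by simp
  next
    fix x :: "'a list" assume "x \<noteq> []" "x \<notin> ?L"
    then have "p x \<le> (1 / 2) ^ (\<Theta> + 1)"
      by (auto simp: p_def power_one_over[symmetric] simp del: power_Suc intro!: power_decreasing)
    then have "p x ^ j \<le> ((1 / 2) ^ (\<Theta> + 1)) ^ j"
      using realizable_bounds[OF p \<open>x \<noteq> []\<close>] by (intro power_mono) auto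
    also have "\<dots> = q * (1 / 2) ^ j" by (simp only: q_def power_mult[symmetric] power_add[symmetric] add_mult_distrib mult_1)
    finally have pj: "p x ^ j \<le> q * (1 / 2) ^ j" .
    have "p x ^ j \<le> 1" using realizable_bounds[OF p \<open>x \<noteq> []\<close>] by (intro power_le_one)
    \<comment> \<open>Bernoulli's inequality acts as the union bound over the rounds.\<close>
    then have "1 - real k * p x ^ j \<le> (1 - p x ^ j) ^ k"
      using Bernoulli_inequality[of "- (p x ^ j)" k] by simp
    then have "1 - (1 - p x ^ j) ^ k \<le> real k * p x ^ j" by simp
    also have "\<dots> \<le> real k * (q * (1 / 2) ^ j)" using pj by (intro mult_left_mono) auto
    also have "\<dots> = (q * real k) * (1 / 2) ^ j" by simp
    also have "\<dots> \<le> (real c + 1) * (\<epsilon> / (real c + 1))" using k(2) j by (intro mult_mono) auto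
    also have "\<dots> = \<epsilon>" by simp
    finally show "1 - (1 - p x ^ j) ^ k \<le> \<epsilon>" .
  qed
qed

section \<open>Simulation by an automaton\<close>

text \<open>The machine collects in every cell the part of the input and the coins seen so far, checks
  the conditions \<open>\<phi>s\<close> one after the other from step \<open>N + 1\<close> on, and then enters the dead state
  represented by \<open>([], [])\<close>.\<close>
fun decode :: "('a::finite) + nat \<Rightarrow> 'a option list \<times> bool list" where
  "decode (Inl a) = ([Some a], [])"
| "decode (Inr k) = from_nat k"

definition encode :: "('a::finite) option list \<times> bool list \<Rightarrow> 'a + nat" where
  "encode v = Inr (to_nat v)"

lemma decode_encode [simp]: "decode (encode v) = v"
  by (simp add: encode_def)

text \<open>The bound on the window is an inequality so that the dead state is included.\<close>

definition info :: "nat \<Rightarrow> ('a option list \<times> bool list) set" where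
  "info T = {(w, c). length c \<le> T \<and> length w \<le> 2 * length c + 1}"

text \<open>The outermost entry of each neighbour's window is all that is new. A missing neighbour
  yields \<open>None\<close>, just what the input has beyond the border.\<close>

definition sim_next :: "nat \<Rightarrow> bool \<Rightarrow> ('a::finite + nat) option \<Rightarrow> 'a + nat \<Rightarrow> ('a + nat) option
    \<Rightarrow> 'a option list \<times> bool list" where
  "sim_next T b l q r =
     (if fst (decode q) = [] \<or> T \<le> length (snd (decode q)) then ([], [])
      else ((case l of None \<Rightarrow> None | Some q' \<Rightarrow> hd (fst (decode q'))) # fst (decode q)
              @ [case r of None \<Rightarrow> None | Some q' \<Rightarrow> last (fst (decode q'))],
            snd (decode q) @ [b]))"

text \<open>The number of stored coins is the clock and selects the slot. Slots start strictly after
  step \<open>N\<close>, because for \<open>N = 0\<close> the states at step \<open>N\<close> are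
  letters, and these are never accepting.\<close>

definition sim_accepts :: "nat \<Rightarrow> ((int \<Rightarrow> 'a option) \<Rightarrow> nat set \<Rightarrow> bool) list \<Rightarrow> 'a option list \<times> bool list \<Rightarrow> bool" where
  "sim_accepts N \<phi>s v \<longleftrightarrow> fst v \<noteq> [] \<and> N < length (snd v) \<and>
     (\<phi>s ! (length (snd v) - N - 1)) (unwindow (length (snd v)) (fst v)) {s. s < N \<and> snd v ! s}"

definition sim :: "nat \<Rightarrow> ((int \<Rightarrow> 'a option) \<Rightarrow> nat set \<Rightarrow> bool) list \<Rightarrow> ('a::finite) paca" where
  "sim N \<phi>s = \<lparr>states = range Inl \<union> encode ` info (N + length \<phi>s),
     acc = encode ` {v \<in> info (N + length \<phi>s). sim_accepts N \<phi>s v},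
     delta = \<lambda>b l q r. encode (sim_next (N + length \<phi>s) b l q r)\<rparr>"

lemma delta_sim: "delta (sim N \<phi>s) b l q r = encode (sim_next (N + length \<phi>s) b l q r)"
  by (simp add: sim_def)

lemma finite_info: "finite (info T :: ('a::finite option list \<times> bool list) set)"
proof (rule finite_subset)
  show "info T \<subseteq> {w :: 'a option list. set w \<subseteq> UNIV \<and> length w \<le> 2 * T + 1} \<times> {c. set c \<subseteq> UNIV \<and> length c \<le> T}"
    by (auto simp: info_def)
qed (intro finite_cartesian_product finite_lists_length_le; simp)

lemma paca_wf_sim: "paca_wf (sim N \<phi>s)"
proof -
  let ?T = "N + length \<phi>s"
  \<comment> \<open>A neighbour in the dead state contributes \<open>hd\<close> or
    \<open>last\<close> of the empty list; membership in \<open>info\<close> depends on lengths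
    only, so any value is fine.\<close>
  have "encode (sim_next ?T b l q r) \<in> encode ` info ?T" if "q \<in> range Inl \<union> encode ` info ?T" for b l q r
  proof -
    have "decode q \<in> info ?T" using that by (auto simp: info_def)
    then have "sim_next ?T b l q r \<in> info ?T"
      by (auto simp: sim_next_def info_def split: prod.splits)
    then show ?thesis by (rule imageI)
  qed
  moreover have "encode ` {v \<in> info ?T. sim_accepts N \<phi>s v} \<subseteq> encode ` info ?T" by blast
  ultimately show ?thesis
    unfolding paca_wf_def sim_def by (simp add: finite_info) blast
qed

section \<open>Behaviour of the simulating machine\<close>

lemma window_0: "window 0 X i = [X i]"
  by (simp add: window_def)

lemma window_Suc: "window (Suc t) X i = X (i - 1 - int t) # window t X i @ [X (i + 1 + int t)]"
proof (rule nth_equalityI)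
  fix k assume "k < length (window (Suc t) X i)"
  then have "k \<le> 2 * t + 2" by (simp add: window_def)
  then consider "k = 0" | j where "k = Suc j" "j < 2 * t + 1" | "k = Suc (2 * t + 1)"
    by (cases k) (auto simp: le_less less_Suc_eq)
  then show "window (Suc t) X i ! k = (X (i - 1 - int t) # window t X i @ [X (i + 1 + int t)]) ! k"
    unfolding window_def by cases (auto simp: nth_append nth_map_upt simp del: upt_Suc intro!: arg_cong[of _ _ X])
qed (simp add: window_def)

lemma hd_window: "hd (window t X i) = X (i - int t)"
  unfolding window_def by (subst hd_map) (auto simp: hd_upt simp del: upt_Suc)

lemma last_window: "last (window t X i) = X (i + int t)"
  unfolding window_def by (subst last_map) (auto simp: add.commute)

context
  fixes N :: nat and \<phi>s :: "((int \<Rightarrow> 'a::finite option) \<Rightarrow> nat set \<Rightarrow> bool) list"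
begin

abbreviation "sim_time \<equiv> N + length \<phi>s"

text \<open>\<open>decode\<close> is not injective: a letter and the encoding of its window of
  radius \<open>0\<close> have the same image. The last two conjuncts tell which of the two
  \<open>q\<close> is, and this decides membership in \<open>acc\<close>.\<close>

lemma cell_sim:
  assumes "t \<le> sim_time" "pad x i \<noteq> None"
  shows "\<exists>q. cell (sim N \<phi>s) (pad x) \<omega> t i = Some q \<and>
    decode q = (window t (pad x) i, map (\<lambda>s. (s, i) \<in> \<omega>) [0..<t]) \<and> (0 < t \<longrightarrow> q = encode (decode q)) \<and>
    (t = 0 \<longrightarrow> q \<in> range Inl)"
  using assms
proof (induction t arbitrary: i)
  case 0
  then show ?case by (auto simp: window_0)
next
  case (Suc t)
  obtain q where q: "cell (sim N \<phi>s) (pad x) \<omega> t i = Some q"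
    "decode q = (window t (pad x) i, map (\<lambda>s. (s, i) \<in> \<omega>) [0..<t])"
    using Suc by force
  have left: "(case cell (sim N \<phi>s) (pad x) \<omega> t (i - 1) of None \<Rightarrow> None | Some q' \<Rightarrow> hd (fst (decode q')))
      = pad x (i - 1 - int t)"
  proof (cases "pad x (i - 1) = None")
    case True
    then have "pad x (i - 1 - int t) = None" using Suc.prems(2) by (auto simp: pad_eq_None)
    moreover have "cell (sim N \<phi>s) (pad x) \<omega> t (i - 1) = None" using True by (simp add: cell_eq_None)
    ultimately show ?thesis by simp
  next
    case False
    then show ?thesis using Suc.IH[of "i - 1"] Suc.prems(1) by (auto simp: hd_window)
  qed
  have right: "(case cell (sim N \<phi>s) (pad x) \<omega> t (i + 1) of None \<Rightarrow> None | Some q' \<Rightarrow> last (fst (decode q')))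
      = pad x (i + 1 + int t)"
  proof (cases "pad x (i + 1) = None")
    case True
    then have "pad x (i + 1 + int t) = None" using Suc.prems(2) by (auto simp: pad_eq_None)
    moreover have "cell (sim N \<phi>s) (pad x) \<omega> t (i + 1) = None" using True by (simp add: cell_eq_None)
    ultimately show ?thesis by simp
  next
    case False
    then show ?thesis using Suc.IH[of "i + 1"] Suc.prems(1) by (auto simp: last_window)
  qed
  have "window t (pad x) i \<noteq> []" by (simp add: window_def)
  then have "sim_next sim_time ((t, i) \<in> \<omega>) (cell (sim N \<phi>s) (pad x) \<omega> t (i - 1)) q (cell (sim N \<phi>s) (pad x) \<omega> t (i + 1))
      = (window (Suc t) (pad x) i, map (\<lambda>s. (s, i) \<in> \<omega>) [0..<Suc t])"
    using Suc.prems(1) by (simp add: sim_next_def q left right window_Suc)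
  then show ?case by (simp add: q delta_sim)
qed

lemma cell_sim_dead:
  assumes "pad x i \<noteq> None"
  shows "cell (sim N \<phi>s) (pad x) \<omega> (Suc sim_time + t) i = Some (encode ([], []))"
proof (induction t)
  case 0
  obtain q where "cell (sim N \<phi>s) (pad x) \<omega> sim_time i = Some q"
    "decode q = (window sim_time (pad x) i, map (\<lambda>s. (s, i) \<in> \<omega>) [0..<sim_time])"
    using cell_sim[OF order_refl assms] by blast
  then show ?case by (simp add: delta_sim sim_next_def)
next
  case (Suc t)
  then show ?case by (simp add: delta_sim sim_next_def)
qed

lemma cell_ok_sim:
  assumes "pad x i \<noteq> None" and loc: "\<And>\<phi>. \<phi> \<in> set \<phi>s \<Longrightarrow> local_in N \<phi>"
  shows "cell_ok (sim N \<phi>s) (pad x) \<omega> t i \<longleftrightarrow>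
    N < t \<and> t \<le> sim_time \<and> (\<phi>s ! (t - N - 1)) (view x i) {s. s < N \<and> (s, i) \<in> \<omega>}"
proof (cases "t \<le> sim_time")
  case True
  obtain q where q: "cell (sim N \<phi>s) (pad x) \<omega> t i = Some q"
    "decode q = (window t (pad x) i, map (\<lambda>s. (s, i) \<in> \<omega>) [0..<t])"
    "0 < t \<Longrightarrow> q = encode (decode q)" "t = 0 \<Longrightarrow> q \<in> range Inl"
    using cell_sim[OF True assms(1)] by blast
  show ?thesis
  proof (cases "N < t")
    case True
    then have "q = encode (window t (pad x) i, map (\<lambda>s. (s, i) \<in> \<omega>) [0..<t])" using q(2,3) by simp
    moreover have "(window t (pad x) i, map (\<lambda>s. (s, i) \<in> \<omega>) [0..<t]) \<in> info sim_time"
      using \<open>t \<le> sim_time\<close> by (simp add: info_def window_def)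
    ultimately have "q \<in> acc (sim N \<phi>s) \<longleftrightarrow> sim_accepts N \<phi>s (window t (pad x) i, map (\<lambda>s. (s, i) \<in> \<omega>) [0..<t])"
      by (auto simp: sim_def) (metis decode_encode)
    also have "\<dots> \<longleftrightarrow> (\<phi>s ! (t - N - 1)) (unwindow t (window t (pad x) i)) {s. s < N \<and> (s, i) \<in> \<omega>}"
    proof -
      have "{s. s < N \<and> map (\<lambda>s. (s, i) \<in> \<omega>) [0..<t] ! s} = {s. s < N \<and> (s, i) \<in> \<omega>}"
        using True by auto
      then show ?thesis using True by (simp add: sim_accepts_def window_def)
    qed
    also have "(\<phi>s ! (t - N - 1)) (unwindow t (window t (pad x) i)) = (\<phi>s ! (t - N - 1)) (view x i)"
    proof (rule local_inD[OF loc])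
      show "\<phi>s ! (t - N - 1) \<in> set \<phi>s" using True \<open>t \<le> sim_time\<close> by (intro nth_mem) auto
      fix d :: int assume "\<bar>d\<bar> \<le> int N"
      then show "unwindow t (window t (pad x) i) d = view x i d"
        using True by (simp add: unwindow_window view_def)
    qed
    finally show ?thesis using q(1) True \<open>t \<le> sim_time\<close> by (simp add: cell_ok_def)
  next
    case False
    have "q \<notin> acc (sim N \<phi>s)"
    proof
      assume "q \<in> acc (sim N \<phi>s)"
      then obtain v where "q = encode v" "sim_accepts N \<phi>s v" by (auto simp: sim_def)
      then show False using q(2) False by (simp add: sim_accepts_def)
    qed
    then show ?thesis using q(1) False by (simp add: cell_ok_def)
  qed
next
  case False
  then obtain t' where "t = Suc sim_time + t'" using le_Suc_ex[of "Suc sim_time" t] by auto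
  then have "cell (sim N \<phi>s) (pad x) \<omega> t i = Some (encode ([], []))"
    using cell_sim_dead[OF assms(1)] by simp
  moreover have "encode ([], []) \<notin> acc (sim N \<phi>s)"
    by (auto simp: sim_def sim_accepts_def) (metis decode_encode fst_conv)
  ultimately show ?thesis using False by (simp add: cell_ok_def)
qed

lemma acc_bound_sim:
  assumes loc: "\<And>\<phi>. \<phi> \<in> set \<phi>s \<Longrightarrow> local_in N \<phi>"
  shows "acc_bound (sim N \<phi>s) (Suc sim_time)"
  unfolding acc_bound_def
proof (intro allI impI)
  fix x :: "'a list" and css assume x: "x \<noteq> []" and css: "\<forall>cs\<in>set css. length cs = length x"
    and acc: "all_acc (sim N \<phi>s) (paca_run (sim N \<phi>s) x css)"
  have "css \<in> coins (length css) (length x)" using css by (simp add: coins_def)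
  from all_acc_iff_cell_ok[OF this order_refl, of "sim N \<phi>s"] acc
  have "cell_ok (sim N \<phi>s) (pad x) (coin_set (length x) css) (length css) 0" by simp
  moreover have "pad x 0 \<noteq> None" using x by (simp add: pad_def)
  ultimately have "length css \<le> sim_time" using cell_ok_sim[OF _ loc] by blast
  then show "\<exists>s<Suc sim_time. s \<le> length css \<and> all_acc (sim N \<phi>s) (paca_run (sim N \<phi>s) x (take s css))"
    using acc by (intro exI[of _ "length css"]) simp
qed

text \<open>All slots read the coins of the first \<open>N\<close> steps only, so the later tosses
  drop out of the probability.\<close>

lemma accept_prob_sim:
  assumes loc: "\<And>\<phi>. \<phi> \<in> set \<phi>s \<Longrightarrow> local_in N \<phi>" and "x \<noteq> []"
  shows "accept_prob (sim N \<phi>s) x = pr (space N x) (some_slot \<phi>s x)"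
proof -
  have event: "accept_event (sim N \<phi>s) (Suc sim_time) x \<omega> \<longleftrightarrow> some_slot \<phi>s x (\<omega> \<inter> space N x)" for \<omega>
  proof -
    have "(\<forall>i. cell_ok (sim N \<phi>s) (pad x) \<omega> t i) \<longleftrightarrow>
        N < t \<and> t \<le> sim_time \<and> slot_event (\<phi>s ! (t - N - 1)) x (\<omega> \<inter> space N x)" for t
    proof -
      have "(\<forall>i. cell_ok (sim N \<phi>s) (pad x) \<omega> t i) \<longleftrightarrow> (\<forall>i\<in>{0..<int (length x)}. cell_ok (sim N \<phi>s) (pad x) \<omega> t i)"
        using cell_ok_outside[of "pad x"] pad_eq_None[of x] by blast
      also have "\<dots> \<longleftrightarrow> (\<forall>i\<in>{0..<int (length x)}. N < t \<and> t \<le> sim_time \<and>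
          (\<phi>s ! (t - N - 1)) (view x i) {s. s < N \<and> (s, i) \<in> \<omega>})"
        by (intro ball_cong refl cell_ok_sim loc) (auto simp: pad_eq_None)
      also have "\<dots> \<longleftrightarrow> (\<forall>i\<in>{0..<int (length x)}. N < t \<and> t \<le> sim_time \<and>
          (\<phi>s ! (t - N - 1)) (view x i) (coins_at (\<omega> \<inter> space N x) i))"
      proof (intro ball_cong refl)
        fix i assume "i \<in> {0..<int (length x)}"
        then have "{s. s < N \<and> (s, i) \<in> \<omega>} = coins_at (\<omega> \<inter> space N x) i"
          by (auto simp: coins_at_def space_def)
        then show "(N < t \<and> t \<le> sim_time \<and> (\<phi>s ! (t - N - 1)) (view x i) {s. s < N \<and> (s, i) \<in> \<omega>}) =
            (N < t \<and> t \<le> sim_time \<and> (\<phi>s ! (t - N - 1)) (view x i) (coins_at (\<omega> \<inter> space N x) i))"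
          by simp
      qed
      also have "\<dots> \<longleftrightarrow> N < t \<and> t \<le> sim_time \<and> slot_event (\<phi>s ! (t - N - 1)) x (\<omega> \<inter> space N x)"
      proof -
        have "0 \<in> {0..<int (length x)}" using \<open>x \<noteq> []\<close> by simp
        then show ?thesis unfolding slot_event_def by blast
      qed
      finally show ?thesis .
    qed
    then have "accept_event (sim N \<phi>s) (Suc sim_time) x \<omega> \<longleftrightarrow>
        (\<exists>t. N < t \<and> t \<le> sim_time \<and> slot_event (\<phi>s ! (t - N - 1)) x (\<omega> \<inter> space N x))"
      by (auto simp: accept_event_def)
    also have "\<dots> \<longleftrightarrow> (\<exists>j<length \<phi>s. slot_event (\<phi>s ! j) x (\<omega> \<inter> space N x))"
    proof
      assume "\<exists>j<length \<phi>s. slot_event (\<phi>s ! j) x (\<omega> \<inter> space N x)"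
      then obtain j where "j < length \<phi>s" "slot_event (\<phi>s ! j) x (\<omega> \<inter> space N x)" by blast
      then show "\<exists>t. N < t \<and> t \<le> sim_time \<and> slot_event (\<phi>s ! (t - N - 1)) x (\<omega> \<inter> space N x)"
        by (intro exI[of _ "N + 1 + j"]) simp
    next
      assume "\<exists>t. N < t \<and> t \<le> sim_time \<and> slot_event (\<phi>s ! (t - N - 1)) x (\<omega> \<inter> space N x)"
      then obtain t where "N < t" "t \<le> sim_time" "slot_event (\<phi>s ! (t - N - 1)) x (\<omega> \<inter> space N x)" by blast
      then show "\<exists>j<length \<phi>s. slot_event (\<phi>s ! j) x (\<omega> \<inter> space N x)"
        by (intro exI[of _ "t - N - 1"]) simp
    qed
    also have "\<dots> \<longleftrightarrow> some_slot \<phi>s x (\<omega> \<inter> space N x)"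
      unfolding some_slot_def by (metis in_set_conv_nth)
    finally show ?thesis .
  qed
  have "acc_bound (sim N \<phi>s) (Suc sim_time)" by (rule acc_bound_sim[OF loc])
  then have "accept_prob (sim N \<phi>s) x = pr (space (Suc sim_time) x) (accept_event (sim N \<phi>s) (Suc sim_time) x)"
    using \<open>x \<noteq> []\<close> by (rule accept_prob_eq_pr)
  also have "\<dots> = pr (space (Suc sim_time) x) (\<lambda>\<omega>. some_slot \<phi>s x (\<omega> \<inter> space N x))"
    by (intro pr_cong event)
  also have "\<dots> = pr (space N x) (\<lambda>\<omega>. some_slot \<phi>s x (\<omega> \<inter> space N x))"
    by (rule pr_restrict) (auto simp: space_def depends_on_def)
  also have "\<dots> = pr (space N x) (some_slot \<phi>s x)"
    by (rule pr_cong) (simp add: inf_absorb1)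
  finally show ?thesis .
qed

end

lemma amplifiable_in_PACA_class:
  fixes L :: "('a::finite) list set"
  assumes "amplifiable L" "L \<subseteq> nonempty_words"
  shows "L \<in> PACA_class"
proof -
  obtain p where p: "realizable p" "\<And>x. x \<noteq> [] \<Longrightarrow> x \<in> L \<Longrightarrow> 1 - 1 / 3 \<le> p x"
    "\<And>x. x \<noteq> [] \<Longrightarrow> x \<notin> L \<Longrightarrow> p x \<le> 1 / 3"
    by (rule amplifiableE[OF assms(1), of "1 / 3"]) auto
  obtain N \<phi>s where loc: "\<And>\<phi>. \<phi> \<in> set \<phi>s \<Longrightarrow> local_in N \<phi>"
    and eq: "\<And>x. x \<noteq> [] \<Longrightarrow> p x = pr (space N x) (some_slot \<phi>s x)"
    using p(1) by (auto simp: realizable_def)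
  have "two_sided (sim N \<phi>s) L"
    unfolding two_sided_def
  proof (intro allI impI conjI)
    fix x :: "'a list" assume x: "x \<noteq> []"
    have prob: "accept_prob (sim N \<phi>s) x = p x" using accept_prob_sim[OF loc x] eq[OF x] by simp
    show "2 / 3 \<le> accept_prob (sim N \<phi>s) x" if "x \<in> L" using p(2)[OF x that] prob by simp
    show "accept_prob (sim N \<phi>s) x \<le> 1 / 3" if "x \<notin> L" using p(3)[OF x that] prob by simp
  qed
  moreover have "paca_const_time (sim N \<phi>s)"
    unfolding paca_const_time_iff using acc_bound_sim[OF loc] by blast
  ultimately show ?thesis using paca_wf_sim assms(2) by (auto simp: PACA_class_def)
qed

section \<open>Locally linearly testable languages\<close>

lemma exists_gap_above:
  fixes \<theta> :: real
  assumes "finite {v \<in> V. v \<le> \<theta> + 1}"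
  obtains \<delta> where "0 < \<delta>" "\<And>v. v \<in> V \<Longrightarrow> \<theta> < v \<Longrightarrow> \<theta> + \<delta> \<le> v"
proof -
  \<comment> \<open>The extra element \<open>\<theta> + 1\<close> keeps the set nonempty and takes
    care of all values above it.\<close>
  let ?F = "insert (\<theta> + 1) {v \<in> {v \<in> V. v \<le> \<theta> + 1}. \<theta> < v}"
  have fin: "finite ?F" by (auto intro: finite_subset[OF _ assms])
  show thesis
  proof (rule that[of "Min ?F - \<theta>"])
    show "0 < Min ?F - \<theta>" using Min_in[OF fin] by auto
    fix v assume v: "v \<in> V" "\<theta> < v"
    show "\<theta> + (Min ?F - \<theta>) \<le> v"
    proof (cases "v \<le> \<theta> + 1")
      case True
      then show ?thesis using v Min_le[OF fin, of v] by simp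
    next
      case False
      then show ?thesis using Min_le[OF fin, of "\<theta> + 1"] by simp
    qed
  qed
qed

text \<open>Only finitely many values of the weighted sum lie below any bound, hence a gap \<open>\<delta>\<close> above
  \<open>\<theta>\<close>; scaling by a large \<open>Q\<close> makes the errors from rounding the weights up smaller than the gap.\<close>
lemma integer_weights:
  fixes \<alpha> :: "'b \<Rightarrow> real"
  assumes A: "finite A" and nonneg: "\<And>m. m \<in> A \<Longrightarrow> 0 \<le> \<alpha> m" and "0 \<le> \<theta>"
  obtains a :: "'b \<Rightarrow> nat" and \<Theta> :: nat
  where "\<And>k. (\<Sum>m\<in>A. \<alpha> m * real (k m)) \<le> \<theta> \<longleftrightarrow> (\<Sum>m\<in>A. a m * k m) \<le> \<Theta>"
proof -
  define P where "P = {m \<in> A. 0 < \<alpha> m}"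
  have "finite P" using A by (simp add: P_def)
  \<comment> \<open>The extra \<open>1\<close> keeps the minimum defined when all weights
    vanish.\<close>
  define \<mu> where "\<mu> = Min (insert 1 (\<alpha> ` P))"
  have \<mu>: "0 < \<mu>" "\<And>m. m \<in> P \<Longrightarrow> \<mu> \<le> \<alpha> m"
  proof -
    show "0 < \<mu>" unfolding \<mu>_def using \<open>finite P\<close> by (subst Min_gr_iff) (auto simp: P_def)
    show "\<mu> \<le> \<alpha> m" if "m \<in> P" for m
      unfolding \<mu>_def using \<open>finite P\<close> that by (intro Min_le) auto
  qed
  define s where "s k = (\<Sum>m\<in>A. \<alpha> m * real (k m))" for k :: "'b \<Rightarrow> nat"
  have s_P: "s k = (\<Sum>m\<in>P. \<alpha> m * real (k m))" for k
    unfolding s_def using A nonneg by (intro sum.mono_neutral_right) (force simp: P_def)+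
  have count: "\<mu> * (\<Sum>m\<in>P. real (k m)) \<le> s k" for k
    unfolding s_P sum_distrib_left using \<mu> by (intro sum_mono mult_right_mono) auto
  have "finite {v \<in> range s. v \<le> \<theta> + 1}"
  proof (rule finite_subset)
    define B where "B = nat \<lfloor>(\<theta> + 1) / \<mu>\<rfloor>"
    show "{v \<in> range s. v \<le> \<theta> + 1} \<subseteq> (\<lambda>k. \<Sum>m\<in>P. \<alpha> m * real (k m)) ` (P \<rightarrow>\<^sub>E {..B})"
    proof
      fix v assume "v \<in> {v \<in> range s. v \<le> \<theta> + 1}"
      then obtain k where k: "v = s k" "s k \<le> \<theta> + 1" by auto
      have "k m \<le> B" if "m \<in> P" for m
      proof -
        have "real (k m) \<le> (\<Sum>m\<in>P. real (k m))" using that \<open>finite P\<close> by (intro member_le_sum) auto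
        then have "\<mu> * real (k m) \<le> \<theta> + 1"
          using count[of k] k(2) mult_left_mono[of "real (k m)" "\<Sum>m\<in>P. real (k m)" \<mu>] \<mu>(1) by linarith
        then have "real (k m) \<le> (\<theta> + 1) / \<mu>" using \<mu>(1) by (simp add: field_simps)
        then show ?thesis unfolding B_def by (simp add: le_nat_floor)
      qed
      \<comment> \<open>Counts of elements of weight zero are unbounded; \<open>restrict\<close>
        forgets them without changing the sum.\<close>
      then have "restrict k P \<in> P \<rightarrow>\<^sub>E {..B}" by auto
      moreover have "v = (\<Sum>m\<in>P. \<alpha> m * real (restrict k P m))" using k(1) by (simp add: s_P)
      ultimately show "v \<in> (\<lambda>k. \<Sum>m\<in>P. \<alpha> m * real (k m)) ` (P \<rightarrow>\<^sub>E {..B})"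
        by (intro image_eqI[where x = "restrict k P"])
    qed
  qed (use \<open>finite P\<close> in \<open>intro finite_imageI finite_PiE; simp\<close>)
  then obtain \<delta> where \<delta>: "0 < \<delta>" "\<And>k. \<theta> < s k \<Longrightarrow> \<theta> + \<delta> \<le> s k"
    by (rule exists_gap_above) auto
  obtain Q :: nat where Q: "\<theta> / \<mu> / \<delta> < real Q" using reals_Archimedean2 by blast
  define a where "a m = nat \<lceil>real Q * \<alpha> m\<rceil>" for m
  \<comment> \<open>If \<open>s k \<le> \<theta>\<close>, at most \<open>\<theta> / \<mu>\<close>
    occurrences have positive weight, and rounding up adds at most \<open>1\<close> for each. The
    choice of \<open>Q\<close> makes this error smaller than the scaled gap
    \<open>Q * \<delta>\<close>.\<close>
  define \<Theta> where "\<Theta> = nat \<lfloor>real Q * \<theta> + \<theta> / \<mu>\<rfloor>"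
  have "0 \<le> real Q * \<theta> + \<theta> / \<mu>" using \<open>0 \<le> \<theta>\<close> \<mu>(1) by simp
  then have \<Theta>: "n \<le> \<Theta> \<longleftrightarrow> real n \<le> real Q * \<theta> + \<theta> / \<mu>" for n
    unfolding \<Theta>_def by (simp add: le_nat_iff le_floor_iff)
  have lower: "real Q * s k \<le> real (\<Sum>m\<in>A. a m * k m)" for k
  proof -
    have "real Q * s k = (\<Sum>m\<in>A. real Q * \<alpha> m * real (k m))"
      by (simp add: s_def sum_distrib_left mult.assoc)
    also have "\<dots> \<le> (\<Sum>m\<in>A. real (a m) * real (k m))"
      by (intro sum_mono mult_right_mono) (auto simp: a_def real_nat_ceiling_ge)
    finally show ?thesis by simp
  qed
  have upper: "real (\<Sum>m\<in>A. a m * k m) \<le> real Q * s k + (\<Sum>m\<in>P. real (k m))" for k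
  proof -
    \<comment> \<open>Zero weights stay zero after rounding, so only counts controlled by
      \<open>\<mu>\<close> enter the error.\<close>
    have "real (\<Sum>m\<in>A. a m * k m) = (\<Sum>m\<in>P. real (a m) * real (k m))"
      using A nonneg unfolding of_nat_sum of_nat_mult
      by (intro sum.mono_neutral_right) (force simp: P_def a_def)+
    also have "\<dots> \<le> (\<Sum>m\<in>P. (real Q * \<alpha> m + 1) * real (k m))"
    proof (intro sum_mono mult_right_mono)
      fix m assume "m \<in> P"
      then have "0 \<le> real Q * \<alpha> m" by (simp add: P_def)
      then show "real (a m) \<le> real Q * \<alpha> m + 1" unfolding a_def by linarith
    qed simp
    also have "\<dots> = real Q * s k + (\<Sum>m\<in>P. real (k m))"
      by (simp add: s_P sum_distrib_left sum.distrib algebra_simps)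
    finally show ?thesis .
  qed
  show thesis
  proof (rule that[of a \<Theta>])
    fix k :: "'b \<Rightarrow> nat"
    have "(\<Sum>m\<in>A. a m * k m) \<le> \<Theta>" if "s k \<le> \<theta>"
    proof -
      have "(\<Sum>m\<in>P. real (k m)) \<le> \<theta> / \<mu>"
        using count[of k] that \<mu>(1) by (simp add: field_simps)
      moreover have "real Q * s k \<le> real Q * \<theta>" using that by (intro mult_left_mono) auto
      ultimately show ?thesis using upper[of k] unfolding \<Theta> by linarith
    qed
    moreover have "\<not> (\<Sum>m\<in>A. a m * k m) \<le> \<Theta>" if "\<not> s k \<le> \<theta>"
    proof -
      have "real Q * (\<theta> + \<delta>) \<le> real Q * s k" using that \<delta>(2) by (intro mult_left_mono) auto
      moreover have "\<theta> / \<mu> < real Q * \<delta>" using Q \<delta>(1) by (simp only: pos_divide_less_eq)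
      ultimately show ?thesis using lower[of k] unfolding \<Theta> by (simp add: algebra_simps)
    qed
    ultimately show "(\<Sum>m\<in>A. \<alpha> m * real (k m)) \<le> \<theta> \<longleftrightarrow> (\<Sum>m\<in>A. a m * k m) \<le> \<Theta>"
      unfolding s_def by blast
  qed
qed

section \<open>Prefixes, suffixes and infix counts from local views\<close>

definition read_word :: "nat \<Rightarrow> (int \<Rightarrow> 'a option) \<Rightarrow> 'a list" where
  "read_word k Y = map the (takeWhile (\<lambda>o'. o' \<noteq> None) (map (\<lambda>d. Y (int d)) [0..<k]))"

lemma read_word_view:
  assumes "p \<le> length x"
  shows "read_word k (view x (int p)) = take k (drop p x)"
proof -
  let ?u = "take k (drop p x)"
  have "map (\<lambda>d. view x (int p) (int d)) [0..<k] = map Some ?u @ replicate (k - length ?u) None"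
  proof (rule nth_equalityI)
    fix d assume "d < length (map (\<lambda>d. view x (int p) (int d)) [0..<k])"
    moreover have "nat (int p + int d) = p + d" by simp
    ultimately show "map (\<lambda>d. view x (int p) (int d)) [0..<k] ! d
        = (map Some ?u @ replicate (k - length ?u) None) ! d"
      using assms by (auto simp: view_def pad_def nth_append)
  qed simp
  moreover have "takeWhile (\<lambda>o'. o' \<noteq> None) (map Some ?u @ replicate j None) = map Some ?u" for j
    by (subst takeWhile_append2) (auto simp: takeWhile_replicate)
  ultimately show ?thesis by (simp add: read_word_def comp_def)
qed

text \<open>Mirroring the view at the last cell turns the suffix into a prefix of the reversed
  word.\<close>

lemma read_word_rev:
  assumes "x \<noteq> []"
  shows "rev (read_word k (\<lambda>d. view x (int (length x) - 1) (- d))) = suff k x"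
proof -
  have "view x (int (length x) - 1) (- d) = view (rev x) 0 d" for d
    by (auto simp: view_def pad_def rev_nth nat_diff_distrib intro!: arg_cong[where f = "(!) x"])
  then show ?thesis using read_word_view[of 0 "rev x" k] by (simp add: suff_def take_rev)
qed

lemma read_word_cong:
  assumes "\<And>d. 0 \<le> d \<Longrightarrow> d < int k \<Longrightarrow> Y d = Y' d"
  shows "read_word k Y = read_word k Y'"
proof -
  have "map (\<lambda>d. Y (int d)) [0..<k] = map (\<lambda>d. Y' (int d)) [0..<k]" using assms by auto
  then show ?thesis unfolding read_word_def by (simp only:)
qed

text \<open>Double counting: positions are sorted by the infix that starts there.\<close>

lemma sum_occ:
  fixes a :: "('a::finite) list \<Rightarrow> nat"
  shows "(\<Sum>m\<in>{m. length m = l}. a m * occ x m) = (\<Sum>p\<in>{p. p + l \<le> length x}. a (take l (drop p x)))"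
proof -
  let ?P = "{p. p + l \<le> length x}" and ?M = "{m :: 'a list. length m = l}"
  have "finite ?M" using finite_lists_length_eq[of "UNIV :: 'a set" l] by simp
  moreover have "finite ?P" by (rule finite_subset[of _ "{..length x}"]) auto
  ultimately have "(\<Sum>p\<in>?P. a (take l (drop p x)))
      = (\<Sum>m\<in>?M. \<Sum>p\<in>{p \<in> ?P. take l (drop p x) = m}. a (take l (drop p x)))"
    by (intro sum.group[symmetric]) auto
  also have "\<dots> = (\<Sum>m\<in>?M. a m * occ x m)"
  proof (rule sum.cong[OF refl])
    fix m :: "'a list" assume "m \<in> ?M"
    then have "{p \<in> ?P. take l (drop p x) = m} = {i. i + length m \<le> length x \<and> take (length m) (drop i x) = m}"
      by auto
    moreover have "(\<Sum>p\<in>{p \<in> ?P. take l (drop p x) = m}. a (take l (drop p x)))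
        = (\<Sum>p\<in>{p \<in> ?P. take l (drop p x) = m}. a m)"
      by (rule sum.cong) auto
    ultimately show "(\<Sum>p\<in>{p \<in> ?P. take l (drop p x) = m}. a (take l (drop p x))) = a m * occ x m"
      by (simp add: occ_def)
  qed
  finally show ?thesis by simp
qed

text \<open>For \<open>l = 0\<close> the empty infix has one more occurrence than there are cells; the last cell
  accounts for it.\<close>
definition occ_weight :: "nat \<Rightarrow> ('a list \<Rightarrow> nat) \<Rightarrow> (int \<Rightarrow> 'a option) \<Rightarrow> nat" where
  "occ_weight l a Y = (if length (read_word l Y) = l then a (read_word l Y) else 0)
     + (if l = 0 \<and> Y 1 = None then a [] else 0)"

lemma sum_occ_weight:
  fixes a :: "('a::finite) list \<Rightarrow> nat"
  assumes "x \<noteq> []"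
  shows "(\<Sum>i\<in>{0..<int (length x)}. occ_weight l a (view x i)) = (\<Sum>m\<in>{m. length m = l}. a m * occ x m)"
proof -
  let ?n = "length x"
  have "(\<Sum>i\<in>{0..<int ?n}. occ_weight l a (view x i)) = (\<Sum>p<?n. occ_weight l a (view x (int p)))"
  proof -
    have "{0..<int ?n} = int ` {..<?n}"
      using image_int_atLeastLessThan[of 0 ?n] by (simp add: atLeast0LessThan)
    then show ?thesis by (simp add: sum.reindex)
  qed
  also have "\<dots> = (\<Sum>p\<in>{p. p + l \<le> ?n}. a (take l (drop p x)))"
  proof (cases "l = 0")
    case True
    have "(\<Sum>p<?n. occ_weight l a (view x (int p))) = (\<Sum>p<?n. a [] + (if p = ?n - 1 then a [] else 0))"
      using True assms
      by (intro sum.cong refl) (auto simp: occ_weight_def read_word_def view_def pad_eq_None)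
    also have "\<dots> = a [] * (?n + 1)" using assms by (simp add: sum.distrib)
    also have "\<dots> = (\<Sum>p\<in>{..?n}. a [])" by simp
    also have "{..?n} = {p. p + l \<le> ?n}" using True by auto
    finally show ?thesis using True by simp
  next
    case False
    have "(\<Sum>p<?n. occ_weight l a (view x (int p)))
        = (\<Sum>p<?n. if p + l \<le> ?n then a (take l (drop p x)) else 0)"
      using False by (intro sum.cong refl) (auto simp: occ_weight_def read_word_view)
    also have "\<dots> = (\<Sum>p\<in>{p \<in> {..<?n}. p + l \<le> ?n}. a (take l (drop p x)))"
      by (rule sum.inter_filter[symmetric]) simp
    also have "{p \<in> {..<?n}. p + l \<le> ?n} = {p. p + l \<le> ?n}" using False by auto
    finally show ?thesis .
  qed
  finally show ?thesis by (simp add: sum_occ)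
qed

text \<open>A missing neighbour tells a cell that it is at a border; in a word of length one the
  same cell makes both checks.\<close>

definition ends_ok :: "nat \<Rightarrow> 'a list set \<Rightarrow> 'a list set \<Rightarrow> (int \<Rightarrow> 'a option) \<Rightarrow> bool" where
  "ends_ok k \<pi> \<sigma> Y \<longleftrightarrow> (Y (- 1) = None \<longrightarrow> read_word k Y \<in> \<pi>) \<and>
     (Y 1 = None \<longrightarrow> rev (read_word k (\<lambda>d. Y (- d))) \<in> \<sigma>)"

lemma all_ends_ok:
  assumes "x \<noteq> []"
  shows "(\<forall>i\<in>{0..<int (length x)}. ends_ok k \<pi> \<sigma> (view x i)) \<longleftrightarrow> pref k x \<in> \<pi> \<and> suff k x \<in> \<sigma>"
proof -
  have first: "view x i (- 1) = None \<longleftrightarrow> i = 0" and last: "view x i 1 = None \<longleftrightarrow> i = int (length x) - 1"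
    if "i \<in> {0..<int (length x)}" for i
    using that by (auto simp: view_def pad_eq_None)
  have "(\<forall>i\<in>{0..<int (length x)}. ends_ok k \<pi> \<sigma> (view x i)) \<longleftrightarrow>
      read_word k (view x 0) \<in> \<pi> \<and> rev (read_word k (\<lambda>d. view x (int (length x) - 1) (- d))) \<in> \<sigma>"
  proof -
    have "0 \<in> {0..<int (length x)}" "int (length x) - 1 \<in> {0..<int (length x)}"
      using assms by (auto simp: Suc_le_eq)
    then show ?thesis unfolding ends_ok_def using first last by blast
  qed
  then show ?thesis using read_word_view[of 0 x k] read_word_rev[OF assms] by (simp add: pref_def)
qed

lemma LLin_amplifiable:
  fixes \<alpha> :: "('a::finite) list \<Rightarrow> real"
  assumes "0 \<le> \<theta>" "\<And>m. length m = l \<Longrightarrow> 0 \<le> \<alpha> m"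
  shows "amplifiable (LLin l \<pi> \<sigma> \<alpha> \<theta>)"
proof -
  let ?M = "{m :: 'a list. length m = l}"
  have fin: "finite ?M" using finite_lists_length_eq[of "UNIV :: 'a set" l] by simp
  obtain a \<Theta> where a: "\<And>k. (\<Sum>m\<in>?M. \<alpha> m * real (k m)) \<le> \<theta> \<longleftrightarrow> (\<Sum>m\<in>?M. a m * k m) \<le> \<Theta>"
    using integer_weights[OF fin, of \<alpha> \<theta>] assms by auto
  have eq: "LLin l \<pi> \<sigma> \<alpha> \<theta> = {x. x \<noteq> [] \<and> (\<forall>i\<in>{0..<int (length x)}. ends_ok (l - 1) \<pi> \<sigma> (view x i)) \<and>
      (\<Sum>i\<in>{0..<int (length x)}. occ_weight l a (view x i)) \<le> \<Theta>}"
    unfolding LLin_def by (simp add: a all_ends_ok sum_occ_weight cong: conj_cong)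
  \<comment> \<open>Radius \<open>l + 1\<close> makes both neighbours visible even for
    \<open>l = 0\<close>.\<close>
  have ends: "local_in (l + 1) (ends_ok (l - 1) \<pi> \<sigma>)"
    unfolding local_in_def
  proof (intro allI impI)
    fix Y Y' :: "int \<Rightarrow> 'a option" assume eq: "\<forall>d. \<bar>d\<bar> \<le> int (l + 1) \<longrightarrow> Y d = Y' d"
    have "read_word (l - 1) Y = read_word (l - 1) Y'"
      "read_word (l - 1) (\<lambda>d. Y (- d)) = read_word (l - 1) (\<lambda>d. Y' (- d))"
      using eq by (auto intro!: read_word_cong)
    moreover have "Y (- 1) = Y' (- 1)" "Y 1 = Y' 1" using eq by auto
    ultimately show "ends_ok (l - 1) \<pi> \<sigma> Y = ends_ok (l - 1) \<pi> \<sigma> Y'" by (simp add: ends_ok_def)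
  qed
  have weight: "local_in (l + 1) (occ_weight l a)"
    unfolding local_in_def
  proof (intro allI impI)
    fix Y Y' :: "int \<Rightarrow> 'a option" assume eq: "\<forall>d. \<bar>d\<bar> \<le> int (l + 1) \<longrightarrow> Y d = Y' d"
    have "read_word l Y = read_word l Y'" using eq by (intro read_word_cong) auto
    moreover have "Y 1 = Y' 1" using eq by auto
    ultimately show "occ_weight l a Y = occ_weight l a Y'" by (simp add: occ_weight_def)
  qed
  \<comment> \<open>The factor \<open>2\<close> is due to the last cell, which counts twice for
    \<open>l = 0\<close>.\<close>
  have bound: "occ_weight l a Y \<le> 2 * (\<Sum>m\<in>?M. a m)" for Y
  proof -
    have le: "a m \<le> (\<Sum>m\<in>?M. a m)" if "length m = l" for m
      using that fin by (intro member_le_sum) auto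
    have "(if length (read_word l Y) = l then a (read_word l Y) else 0) \<le> (\<Sum>m\<in>?M. a m)"
      using le[of "read_word l Y"] by simp
    moreover have "(if l = 0 \<and> Y 1 = None then a [] else 0) \<le> (\<Sum>m\<in>?M. a m)"
      using le[of "[]"] by simp
    ultimately show ?thesis unfolding occ_weight_def by linarith
  qed
  show ?thesis unfolding eq by (rule amplifiable_threshold[OF ends weight bound])
qed

lemma LLT_closure_amplifiable:
  "L \<in> LLT_closure \<Longrightarrow> amplifiable L \<and> L \<subseteq> nonempty_words"
proof (induction rule: LLT_closure.induct)
  case (base L)
  then obtain l \<pi> \<sigma> \<alpha> \<theta> where L: "L = LLin l \<pi> \<sigma> \<alpha> \<theta>"
    and *: "0 \<le> \<theta>" "\<And>m. length m = l \<Longrightarrow> 0 \<le> \<alpha> m"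
    by (auto simp: LLT_class_def)
  have "amplifiable L" unfolding L using * by (rule LLin_amplifiable)
  moreover have "L \<subseteq> nonempty_words" unfolding L by (auto simp: LLin_def nonempty_words_def)
  ultimately show ?case by simp
qed (auto intro: amplifiable_Un amplifiable_Int)

theorem theorem4:
  shows "(LLT_closure :: ('a::finite) list set set) \<subseteq> PACA_class
     \<and> (PACA_class :: 'a list set set) \<subseteq> LTT_class
     \<and> (card (UNIV :: 'a set) \<ge> 2 \<longrightarrow> (PACA_class :: 'a list set set) \<noteq> LTT_class)"
proof (intro conjI impI)
  show "(LLT_closure :: 'a list set set) \<subseteq> PACA_class"
    using LLT_closure_amplifiable amplifiable_in_PACA_class by blast
  show "(PACA_class :: 'a list set set) \<subseteq> LTT_class" by (rule PACA_class_subset_LTT_class)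
  \<comment> \<open>Over a single letter \<open>containing a\<close> would consist of all nonempty
    words and separate nothing.\<close>
  assume "card (UNIV :: 'a set) \<ge> 2"
  then obtain S :: "'a set" where "card S = 2" by (metis obtain_subset_with_card_n)
  then obtain a b :: 'a where "a \<noteq> b" by (auto simp: card_2_iff)
  then have "containing a \<notin> PACA_class" by (rule containing_not_in_PACA_class)
  then show "(PACA_class :: 'a list set set) \<noteq> LTT_class" using containing_in_LTT_class[of a] by blast
qed

end
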